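(* Let $S$ be a weakly cancellative Cu-semigroup satisfying (O5). Then, given a finite $\ll$-increasing sequence $s_1\ll\cdots\ll s_n$ in $S$ and a compact element $p\in S$ such that $s_n\le p$, there exists a Cu-morphism $\phi\colon\mathrm{Lsc}([0,1],\overline{\mathbb{N}})\to S$ such that $\phi(\chi_{((n-k)/n,1]})=s_k$ for every $1\le k\le n$ and $\phi(1)=p$.
   Context: A positively ordered monoid is a commutative monoid $S$ with a partial order compatible with addition such that $0\le x$ for all $x\in S$. For $x,y\in S$ write $x\ll y$ if for every increasing sequence $(z_n)_n$ in $S$ whose supremum exists and satisfies $y\le \sup_n z_n$, there is $n$ with $x\le z_n$. An element $x$ is compact if $x\ll x$. A Cu-semigroup is a positively ordered monoid $S$ such that: (O1) every increasing sequence in $S$ has a supremum; (O2) every element is the supremum of a $\ll$-increasing sequence; (O3) $x'\ll x$ and $y'\ll y$ imply $x'+y'\ll x+y$; (O4) $\sup_n x_n+\sup_n y_n=\sup_n(x_n+y_n)$ for all increasing sequences $(x_n)_n,(y_n)_n$. A Cu-morphism is a map between Cu-semigroups preserving $0$, addition, order, the relation $\ll$, and suprema of increasing sequences. (O5): whenever $x+y\le z$, $x'\ll x$ and $y'\ll y$, there exists $c$ with $x'+c\le z\le x+c$ and $y'\ll c$. Weak cancellation: $x+z\ll y+z$ implies $x\ll y$. $\overline{\mathbb{N}}=\{0,1,2,\dots\}\cup\{\infty\}$, and $\mathrm{Lsc}([0,1],\overline{\mathbb{N}})$ is the Cu-semigroup of lower-semicontinuous functions $[0,1]\to\overline{\mathbb{N}}$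 with pointwise order and addition; $\chi_U$ is the indicator function of $U$ and $1$ is the constant function. *)

theory Defs
  imports "HOL-Analysis.Analysis"
begin

section \<open>Cu-semigroups\<close>

text \<open>
  Inside the classes, \<open>monotone (\<le>) (\<le>) z\<close> is what \<open>incseq z\<close> abbreviates; the abbreviation
  itself carries a sort constraint that is not available there.
\<close>

context order
begin

definition is_seq_sup :: "(nat \<Rightarrow> 'a) \<Rightarrow> 'a \<Rightarrow> bool"
  where "is_seq_sup z s \<longleftrightarrow> (\<forall>n. z n \<le> s) \<and> (\<forall>u. (\<forall>n. z n \<le> u) \<longrightarrow> s \<le> u)"

definition way_below :: "'a \<Rightarrow> 'a \<Rightarrow> bool"  (infix \<open>\<lless>\<close> 50)
  where "x \<lless> y \<longleftrightarrow> (\<forall>z s. monotone (\<le>) (\<le>) z \<longrightarrow> is_seq_sup z s \<longrightarrow> y \<le> s \<longrightarrow> (\<exists>n. x \<le> z n))"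

definition compact_elem :: "'a \<Rightarrow> bool"
  where "compact_elem x \<longleftrightarrow> x \<lless> x"

end

class positively_ordered_monoid = ordered_comm_monoid_add +
  assumes zero_least: "0 \<le> x"

class cu_semigroup = positively_ordered_monoid +
  assumes O1: "monotone (\<le>) (\<le>) z \<Longrightarrow> \<exists>s. is_seq_sup z s"
    and O2: "\<exists>z. (\<forall>n. z n \<lless> z (Suc n)) \<and> is_seq_sup z x"
    and O3: "x' \<lless> x \<Longrightarrow> y' \<lless> y \<Longrightarrow> x' + y' \<lless> x + y"
    and O4: "monotone (\<le>) (\<le>) u \<Longrightarrow> monotone (\<le>) (\<le>) v \<Longrightarrow> is_seq_sup u a \<Longrightarrow> is_seq_sup v b
              \<Longrightarrow> is_seq_sup (\<lambda>n. u n + v n) (a + b)"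

class cu_semigroup_O5 = cu_semigroup +
  assumes O5: "x + y \<le> z \<Longrightarrow> x' \<lless> x \<Longrightarrow> y' \<lless> y \<Longrightarrow>
                 \<exists>c. x' + c \<le> z \<and> z \<le> x + c \<and> y' \<lless> c"

class weakly_cancellative_cu_semigroup = cu_semigroup +
  assumes weak_cancellation: "x + z \<lless> y + z \<Longrightarrow> x \<lless> y"

definition cu_morphism :: "('a::cu_semigroup \<Rightarrow> 'b::cu_semigroup) \<Rightarrow> bool"
  where "cu_morphism \<phi> \<longleftrightarrow>
    \<phi> 0 = 0 \<and>
    (\<forall>x y. \<phi> (x + y) = \<phi> x + \<phi> y) \<and>
    (\<forall>x y. x \<le> y \<longrightarrow> \<phi> x \<le> \<phi> y) \<and>
    (\<forall>x y. x \<lless> y \<longrightarrow> \<phi> x \<lless> \<phi> y) \<and>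
    (\<forall>z s. incseq z \<longrightarrow> is_seq_sup z s \<longrightarrow> is_seq_sup (\<lambda>n. \<phi> (z n)) (\<phi> s))"


section \<open>Lower-semicontinuous functions on the unit interval\<close>

definition lsc_on :: "real set \<Rightarrow> (real \<Rightarrow> enat) \<Rightarrow> bool"
  where "lsc_on A f \<longleftrightarrow> (\<forall>c. openin (top_of_set A) {x \<in> A. c < f x})"

text \<open>
  Functions on \<open>[0,1]\<close> are represented by functions on \<open>\<real>\<close> that are \<open>0\<close> outside \<open>[0,1]\<close>;
  this normalisation only serves to make the representation unique.
\<close>

typedef lsc01 = "{f :: real \<Rightarrow> enat. lsc_on {0..1} f \<and> (\<forall>x. x \<notin> {0..1} \<longrightarrow> f x = 0)}"
  morphisms lsc_apply Abs_lsc01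
  by (rule exI[of _ "\<lambda>_. 0"]) (simp add: lsc_on_def)

setup_lifting type_definition_lsc01

lemma lsc_onI:
  assumes "\<And>x. x \<in> A \<Longrightarrow> \<forall>c < f x. \<exists>r>0. \<forall>y\<in>A. dist y x < r \<longrightarrow> c < f y"
  shows "lsc_on A f"
  unfolding lsc_on_def
proof
  fix c
  show "openin (top_of_set A) {x \<in> A. c < f x}"
    unfolding openin_euclidean_subtopology_iff using assms by blast
qed

lemma lsc_onD:
  assumes "lsc_on A f" "x \<in> A" "c < f x"
  shows "\<exists>r>0. \<forall>y\<in>A. dist y x < r \<longrightarrow> c < f y"
proof -
  have "openin (top_of_set A) {x \<in> A. c < f x}"
    using assms(1) by (simp add: lsc_on_def)
  then show ?thesis
    unfolding openin_euclidean_subtopology_iff using assms(2,3) by blast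
qed

lemma lsc_onD_fin:
  assumes "lsc_on A f" "x \<in> A" "enat m \<le> f x"
  shows "\<exists>r>0. \<forall>y\<in>A. dist y x < r \<longrightarrow> enat m \<le> f y"
proof (cases m)
  case 0
  then show ?thesis
    by (auto intro!: exI[of _ 1] simp flip: zero_enat_def)
next
  case (Suc k)
  then have "enat k < f x"
    using assms(3) by (simp add: Suc_ile_eq)
  from lsc_onD[OF assms(1,2) this] show ?thesis
    using Suc by (simp add: Suc_ile_eq)
qed

lemma lsc_on_finI:
  assumes "\<And>x m. x \<in> A \<Longrightarrow> enat m \<le> f x \<Longrightarrow> \<exists>r>0. \<forall>y\<in>A. dist y x < r \<longrightarrow> enat m \<le> f y"
  shows "lsc_on A f"
proof (rule lsc_onI, intro allI impI)
  fix x c assume x: "x \<in> A" and c: "c < f x"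
  then obtain k where k: "c = enat k" by (cases c) auto
  with c have "enat (Suc k) \<le> f x" by (simp add: Suc_ile_eq)
  from assms[OF x this] show "\<exists>r>0. \<forall>y\<in>A. dist y x < r \<longrightarrow> c < f y"
    by (simp add: Suc_ile_eq k)
qed

lemma enat_add_split:
  assumes "enat m \<le> a + b"
  obtains i j where "enat i \<le> a" "enat j \<le> b" "m \<le> i + j"
proof (cases a)
  case (enat i)
  show ?thesis
  proof (cases b)
    case (enat j)
    then show ?thesis using \<open>a = enat i\<close> assms that[of i j] by auto
  next
    case infinity
    then show ?thesis using \<open>a = enat i\<close> that[of i m] by auto
  qed
next
  case infinity
  then show ?thesis using that[of m 0] by (auto simp flip: zero_enat_def)
qed

lemma lsc_on_add:
  assumes "lsc_on A f" "lsc_on A g"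
  shows "lsc_on A (\<lambda>x. f x + g x)"
proof (rule lsc_on_finI)
  fix x m assume x: "x \<in> A" and m: "enat m \<le> f x + g x"
  obtain i j where ij: "enat i \<le> f x" "enat j \<le> g x" "m \<le> i + j"
    using m by (rule enat_add_split)
  obtain r where r: "r > 0" "\<forall>y\<in>A. dist y x < r \<longrightarrow> enat i \<le> f y"
    using lsc_onD_fin[OF assms(1) x ij(1)] by blast
  obtain s where s: "s > 0" "\<forall>y\<in>A. dist y x < s \<longrightarrow> enat j \<le> g y"
    using lsc_onD_fin[OF assms(2) x ij(2)] by blast
  have "enat m \<le> f y + g y" if "y \<in> A" "dist y x < min r s" for y
  proof -
    have "enat i + enat j \<le> f y + g y"
      using r(2) s(2) that by (intro add_mono) auto
    moreover have "enat m \<le> enat i + enat j" using ij(3) by simp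
    ultimately show ?thesis by (rule order_trans[rotated])
  qed
  then show "\<exists>r>0. \<forall>y\<in>A. dist y x < r \<longrightarrow> enat m \<le> f y + g y"
    using r(1) s(1) by (intro exI[of _ "min r s"]) auto
qed

lemma lsc_on_SUP:
  assumes "\<And>n. lsc_on A (f n)"
  shows "lsc_on A (\<lambda>x. SUP n. f n x)"
proof (rule lsc_onI, intro allI impI)
  fix x c assume "x \<in> A" "c < (SUP n. f n x)"
  then obtain n where "c < f n x" by (auto simp: less_SUP_iff)
  from lsc_onD[OF assms \<open>x \<in> A\<close> this]
  show "\<exists>r>0. \<forall>y\<in>A. dist y x < r \<longrightarrow> c < (SUP n. f n y)"
    by (auto simp: less_SUP_iff)
qed

instantiation lsc01 :: ordered_comm_monoid_add
begin

lift_definition zero_lsc01 :: lsc01 is "\<lambda>_. 0"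
  by (simp add: lsc_on_def)

lift_definition plus_lsc01 :: "lsc01 \<Rightarrow> lsc01 \<Rightarrow> lsc01" is "\<lambda>f g x. f x + g x"
  by (auto intro: lsc_on_add)

lift_definition less_eq_lsc01 :: "lsc01 \<Rightarrow> lsc01 \<Rightarrow> bool" is "\<lambda>f g. \<forall>x. f x \<le> g x" .

definition less_lsc01 :: "lsc01 \<Rightarrow> lsc01 \<Rightarrow> bool"
  where "less_lsc01 f g \<longleftrightarrow> f \<le> g \<and> \<not> g \<le> f"

instance
proof
  fix a b c :: lsc01
  show "a + b + c = a + (b + c)" by transfer (simp add: add.assoc)
  show "a + b = b + a" by transfer (simp add: add.commute)
  show "0 + a = a" by transfer simp
  show "(a < b) = (a \<le> b \<and> \<not> b \<le> a)" by (simp add: less_lsc01_def)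
  show "a \<le> a" by transfer simp
  show "a \<le> b \<Longrightarrow> b \<le> c \<Longrightarrow> a \<le> c" by transfer (blast intro: order_trans)
  show "a \<le> b \<Longrightarrow> b \<le> a \<Longrightarrow> a = b" by transfer (blast intro: antisym)
  show "a \<le> b \<Longrightarrow> c + a \<le> c + b" by transfer (auto intro: add_left_mono)
qed

end

text \<open>
  The indicator function of \<open>U\<close>; meaningful for \<open>U\<close> relatively open in \<open>[0,1]\<close>,
  cf. \<open>lsc_apply_indicator\<close>.
\<close>

definition lsc_indicator :: "real set \<Rightarrow> lsc01"
  where "lsc_indicator U = Abs_lsc01 (indicator U)"

lemma lsc_apply_indicator:
  assumes "openin (top_of_set {0..1}) U"
  shows "lsc_apply (lsc_indicator U) = indicator U"
proof -
  have U: "U \<subseteq> {0..1}" using assms openin_imp_subset by blast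
  have "openin (top_of_set {0..1}) {x \<in> {0..1}. c < (indicator U x :: enat)}" for c
  proof (cases "c = 0")
    case True
    then have "{x \<in> {0..1}. c < (indicator U x :: enat)} = U"
      using U by (auto simp: indicator_def)
    then show ?thesis using assms by simp
  next
    case False
    then have "\<not> c < 1" using iless_eSuc0[of c] unfolding one_eSuc by blast
    then have "{x \<in> {0..1}. c < (indicator U x :: enat)} = {}"
      by (auto simp: indicator_def)
    then show ?thesis by (metis openin_empty)
  qed
  moreover have "\<forall>x. x \<notin> {0..1} \<longrightarrow> (indicator U x :: enat) = 0"
    using U by (auto simp: indicator_def)
  ultimately show ?thesis
    unfolding lsc_indicator_def by (subst Abs_lsc01_inverse) (auto simp: lsc_on_def)
qed

lemma openin_unit_interval_upper:
  assumes "0 \<le> a"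
  shows "openin (top_of_set {0..1}) {a<..1::real}"
proof -
  have "{a<..1} = {0..1} \<inter> {a<..}" using assms by auto
  then show ?thesis by (metis open_greaterThan openin_open_Int)
qed

instantiation lsc01 :: one
begin

lift_definition one_lsc01 :: lsc01 is "\<lambda>x. if x \<in> {0..1} then 1 else 0"
proof (intro conjI)
  have "lsc_on {0..1} (\<lambda>_::real. 1)"
    by (intro lsc_onI) (auto intro: exI[of _ 1])
  then show "lsc_on {0..1} (\<lambda>x::real. if x \<in> {0..1} then 1 else 0)"
    by (simp add: lsc_on_def cong: conj_cong)
qed auto

instance ..

end


section \<open>The Cu-semigroup structure of the lower-semicontinuous functions\<close>

lemma is_seq_sup_unique: "is_seq_sup z s \<Longrightarrow> is_seq_sup z t \<Longrightarrow> s = t"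
  by (auto simp: is_seq_sup_def intro: antisym)

lemma lsc_on_lsc_apply: "lsc_on {0..1} (lsc_apply f)"
  using lsc_apply[of f] by simp

lemma lsc_apply_outside: "x \<notin> {0..1} \<Longrightarrow> lsc_apply f x = 0"
  using lsc_apply[of f] by simp

lemma lsc_apply_plus: "lsc_apply (f + g) x = lsc_apply f x + lsc_apply g x"
  by transfer simp

lemma lsc_le_iff: "f \<le> g \<longleftrightarrow> (\<forall>x. lsc_apply f x \<le> lsc_apply g x)"
  by transfer simp

lemma lsc_le_iff_on: "f \<le> g \<longleftrightarrow> (\<forall>x\<in>{0..1}. lsc_apply f x \<le> lsc_apply g x)"
  unfolding lsc_le_iff by (metis lsc_apply_outside order_refl)

lemma lsc_SUP_exists: "\<exists>s. \<forall>x. lsc_apply s x = (SUP n. lsc_apply (z n) x)"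
proof -
  have "lsc_on {0..1} (\<lambda>x. SUP n. lsc_apply (z n) x)"
    by (intro lsc_on_SUP lsc_on_lsc_apply)
  then have "lsc_apply (Abs_lsc01 (\<lambda>x. SUP n. lsc_apply (z n) x)) = (\<lambda>x. SUP n. lsc_apply (z n) x)"
    by (intro Abs_lsc01_inverse) (simp add: lsc_apply_outside)
  then show ?thesis by metis
qed

lemma lsc_is_seq_sup_iff:
  "is_seq_sup z s \<longleftrightarrow> (\<forall>x. lsc_apply s x = (SUP n. lsc_apply (z n) x))"
proof -
  have *: "is_seq_sup z t" if "\<forall>x. lsc_apply t x = (SUP n. lsc_apply (z n) x)" for t
    unfolding is_seq_sup_def using that by (auto simp: lsc_le_iff intro: SUP_upper SUP_least)
  obtain t where t: "\<forall>x. lsc_apply t x = (SUP n. lsc_apply (z n) x)"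
    using lsc_SUP_exists by blast
  show ?thesis
    using * t is_seq_sup_unique[OF *[OF t]] by blast
qed

lemma enat_leI: "(\<And>m. enat m \<le> a \<Longrightarrow> enat m \<le> b) \<Longrightarrow> a \<le> b"
proof (cases a)
  case infinity
  assume *: "\<And>m. enat m \<le> a \<Longrightarrow> enat m \<le> b"
  have "b = \<infinity>"
  proof (cases b)
    case (enat k)
    then show ?thesis using *[of "Suc k"] infinity by simp
  qed
  then show ?thesis by simp
qed auto

lemma enat_le_SUP:
  fixes a :: "nat \<Rightarrow> enat"
  assumes "enat m \<le> (SUP n. a n)"
  shows "\<exists>n. enat m \<le> a n"
proof (cases m)
  case 0
  then show ?thesis by (auto simp flip: zero_enat_def)
next
  case (Suc k)
  then have "enat k < (SUP n. a n)" using assms by (simp add: Suc_ile_eq)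
  then show ?thesis using Suc by (auto simp: less_SUP_iff Suc_ile_eq)
qed

lemma enat_SUP_add:
  fixes a b :: "nat \<Rightarrow> enat"
  assumes "incseq a" "incseq b"
  shows "(SUP n. a n + b n) = (SUP n. a n) + (SUP n. b n)"
proof (rule antisym)
  show "(SUP n. a n + b n) \<le> (SUP n. a n) + (SUP n. b n)"
    by (intro SUP_least add_mono SUP_upper) auto
next
  show "(SUP n. a n) + (SUP n. b n) \<le> (SUP n. a n + b n)"
  proof (rule enat_leI)
    fix m assume "enat m \<le> (SUP n. a n) + (SUP n. b n)"
    then obtain i j where ij: "enat i \<le> (SUP n. a n)" "enat j \<le> (SUP n. b n)" "m \<le> i + j"
      by (rule enat_add_split)
    obtain k l where kl: "enat i \<le> a k" "enat j \<le> b l"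
      using enat_le_SUP[OF ij(1)] enat_le_SUP[OF ij(2)] by blast
    have "enat m \<le> enat i + enat j" using ij(3) by simp
    also have "\<dots> \<le> a (max k l) + b (max k l)"
    proof (rule add_mono)
      show "enat i \<le> a (max k l)"
        by (rule order_trans[OF kl(1) incseqD[OF assms(1)]]) simp
      show "enat j \<le> b (max k l)"
        by (rule order_trans[OF kl(2) incseqD[OF assms(2)]]) simp
    qed
    also have "\<dots> \<le> (SUP n. a n + b n)" by (rule SUP_upper) simp
    finally show "enat m \<le> (SUP n. a n + b n)" .
  qed
qed

definition locally_between :: "lsc01 \<Rightarrow> lsc01 \<Rightarrow> bool"
  where "locally_between f g \<longleftrightarrow> (\<forall>x\<in>{0..1}. \<exists>m. enat m \<le> lsc_apply g x \<and>
      (\<exists>r>0. \<forall>y\<in>{0..1}. dist y x < r \<longrightarrow> lsc_apply f y \<le> enat m))"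

lemma locally_between_mono:
  assumes "f' \<le> f" "locally_between f g" "g \<le> g'"
  shows "locally_between f' g'"
  unfolding locally_between_def
proof
  fix x :: real assume "x \<in> {0..1}"
  then obtain m r where mr: "enat m \<le> lsc_apply g x" "r > 0"
    "\<forall>y\<in>{0..1}. dist y x < r \<longrightarrow> lsc_apply f y \<le> enat m"
    using assms(2) unfolding locally_between_def by blast
  have "enat m \<le> lsc_apply g' x"
    using mr(1) assms(3) order_trans unfolding lsc_le_iff by blast
  moreover have "\<forall>y\<in>{0..1}. dist y x < r \<longrightarrow> lsc_apply f' y \<le> enat m"
    using mr(3) assms(1) order_trans unfolding lsc_le_iff by blast
  ultimately show "\<exists>m. enat m \<le> lsc_apply g' x \<and>
      (\<exists>r>0. \<forall>y\<in>{0..1}. dist y x < r \<longrightarrow> lsc_apply f' y \<le> enat m)"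
    using mr(2) by blast
qed

lemma locally_between_imp_le:
  assumes "locally_between f g"
  shows "f \<le> g"
  unfolding lsc_le_iff_on
proof
  fix x :: real assume x: "x \<in> {0..1}"
  then obtain m r where mr: "enat m \<le> lsc_apply g x" "r > 0"
    "\<forall>y\<in>{0..1}. dist y x < r \<longrightarrow> lsc_apply f y \<le> enat m"
    using assms unfolding locally_between_def by blast
  then have "lsc_apply f x \<le> enat m" using x by simp
  then show "lsc_apply f x \<le> lsc_apply g x" using mr(1) by (rule order_trans)
qed

lemma locally_between_add:
  assumes "locally_between f g" "locally_between f' g'"
  shows "locally_between (f + f') (g + g')"
  unfolding locally_between_def
proof
  fix x :: real assume x: "x \<in> {0..1}"
  obtain m r where mr: "enat m \<le> lsc_apply g x" "r > 0"
    "\<forall>y\<in>{0..1}. dist y x < r \<longrightarrow> lsc_apply f y \<le> enat m"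
    using assms(1) x unfolding locally_between_def by blast
  obtain m' r' where mr': "enat m' \<le> lsc_apply g' x" "r' > 0"
    "\<forall>y\<in>{0..1}. dist y x < r' \<longrightarrow> lsc_apply f' y \<le> enat m'"
    using assms(2) x unfolding locally_between_def by blast
  have "enat (m + m') \<le> lsc_apply (g + g') x"
    using add_mono[OF mr(1) mr'(1)] by (simp add: lsc_apply_plus)
  moreover have "lsc_apply (f + f') y \<le> enat (m + m')"
    if "y \<in> {0..1}" "dist y x < min r r'" for y
    using add_mono[of "lsc_apply f y" "enat m" "lsc_apply f' y" "enat m'"] mr(3) mr'(3) that
    by (simp add: lsc_apply_plus)
  ultimately show "\<exists>m. enat m \<le> lsc_apply (g + g') x \<and>
      (\<exists>r>0. \<forall>y\<in>{0..1}. dist y x < r \<longrightarrow> lsc_apply (f + f') y \<le> enat m)"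
    using mr(2) mr'(2) by (intro exI[of _ "m + m'"] conjI exI[of _ "min r r'"]) auto
qed

lemma locally_between_imp_way_below:
  assumes "locally_between f g"
  shows "f \<lless> g"
  unfolding way_below_def
proof (intro allI impI)
  fix z s assume z: "incseq z" and s: "is_seq_sup z s" and gs: "g \<le> s"
  have "\<exists>n r. r > 0 \<and> (\<forall>y\<in>{0..1}. dist y x < r \<longrightarrow> lsc_apply f y \<le> lsc_apply (z n) y)"
    if x: "x \<in> {0..1}" for x
  proof -
    obtain m r where mr: "enat m \<le> lsc_apply g x" "r > 0"
      "\<forall>y\<in>{0..1}. dist y x < r \<longrightarrow> lsc_apply f y \<le> enat m"
      using assms x unfolding locally_between_def by blast
    have "enat m \<le> lsc_apply s x"
      using mr(1) gs order_trans unfolding lsc_le_iff by blast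
    then have "enat m \<le> (SUP n. lsc_apply (z n) x)"
      using s unfolding lsc_is_seq_sup_iff by simp
    then obtain n where n: "enat m \<le> lsc_apply (z n) x"
      using enat_le_SUP by blast
    obtain r' where r': "r' > 0" "\<forall>y\<in>{0..1}. dist y x < r' \<longrightarrow> enat m \<le> lsc_apply (z n) y"
      using lsc_onD_fin[OF lsc_on_lsc_apply x n] by blast
    have "lsc_apply f y \<le> lsc_apply (z n) y" if "y \<in> {0..1}" "dist y x < min r r'" for y
      by (rule order_trans[of _ "enat m"]) (use that mr(3) r'(2) in auto)
    then show ?thesis
      using mr(2) r'(1) by (intro exI[of _ n] exI[of _ "min r r'"]) simp
  qed
  then obtain N R where NR: "\<And>x. x \<in> {0..1} \<Longrightarrow> R x > 0"
    "\<And>x y. x \<in> {0..1} \<Longrightarrow> y \<in> {0..1} \<Longrightarrow> dist y x < R x \<Longrightarrow>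
       lsc_apply f y \<le> lsc_apply (z (N x)) y"
    by metis
  have "{0..1::real} \<subseteq> (\<Union>x\<in>{0..1}. ball x (R x))"
    using NR(1) by force
  then obtain C where C: "C \<subseteq> {0..1}" "finite C" "{0..1} \<subseteq> (\<Union>x\<in>C. ball x (R x))"
    by (rule compactE_image[OF compact_Icc open_ball])
  have "f \<le> z (Max (N ` C))"
    unfolding lsc_le_iff_on
  proof
    fix y :: real assume y: "y \<in> {0..1}"
    then obtain x where x: "x \<in> C" "dist y x < R x"
      using C(3) by (auto simp: dist_commute)
    have "N x \<le> Max (N ` C)" using C(2) x(1) by simp
    then have "z (N x) \<le> z (Max (N ` C))" using z by (rule incseqD[rotated])
    then have "lsc_apply (z (N x)) y \<le> lsc_apply (z (Max (N ` C))) y"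
      by (simp add: lsc_le_iff)
    moreover have "lsc_apply f y \<le> lsc_apply (z (N x)) y"
      using NR(2)[of x y] C(1) x y by blast
    ultimately show "lsc_apply f y \<le> lsc_apply (z (Max (N ` C))) y" by (rule order_trans[rotated])
  qed
  then show "\<exists>n. f \<le> z n" ..
qed

lemma lsc_approximation:
  "\<exists>h. (\<forall>k. locally_between (h k) (h (Suc k))) \<and> is_seq_sup h f"
proof -
  define \<rho> :: "nat \<Rightarrow> real" where "\<rho> k = 1 / real (Suc k)" for k
  have \<rho>: "\<rho> k > 0" "\<rho> (Suc k) < \<rho> k" for k
    by (auto simp: \<rho>_def field_simps)
  define H :: "nat \<Rightarrow> real \<Rightarrow> enat" where
    "H k x = (if x \<in> {0..1} then min (enat k) (INF y\<in>{0..1} \<inter> cball x (\<rho> k). lsc_apply f y) else 0)"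
    for k x
  have H_ge: "enat m \<le> H k x \<longleftrightarrow>
      m \<le> k \<and> (\<forall>y\<in>{0..1}. dist x y \<le> \<rho> k \<longrightarrow> enat m \<le> lsc_apply f y)"
    if "x \<in> {0..1}" for m k x
    using that by (auto simp: H_def le_INF_iff)
  have "lsc_on {0..1} (H k)" for k
  proof (rule lsc_on_finI)
    fix x :: real and m
    assume x: "x \<in> {0..1}" and "enat m \<le> H k x"
    then have m: "m \<le> k" "\<forall>y\<in>{0..1}. dist x y \<le> \<rho> k \<longrightarrow> enat m \<le> lsc_apply f y"
      by (auto simp: H_ge)
    define C where "C = {y \<in> {0..1}. \<not> enat m \<le> lsc_apply f y}"
    have "openin (top_of_set {0..1}) {y \<in> {0..1}. enat m \<le> lsc_apply f y}"
      unfolding openin_euclidean_subtopology_iff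
      using lsc_onD_fin[OF lsc_on_lsc_apply, of _ m f] by blast
    then have "closedin (top_of_set {0..1}) ({0..1} - {y \<in> {0..1}. enat m \<le> lsc_apply f y})"
      by (intro closedin_diff) auto
    also have "{0..1} - {y \<in> {0..1}. enat m \<le> lsc_apply f y} = C"
      by (auto simp: C_def)
    finally have "closed C" by (rule closedin_closed_trans) simp
    show "\<exists>r>0. \<forall>y\<in>{0..1}. dist y x < r \<longrightarrow> enat m \<le> H k y"
    proof (cases "C = {}")
      case True
      then have "enat m \<le> H k y" if "y \<in> {0..1}" for y
        using m(1) that by (auto simp: H_ge C_def)
      then show ?thesis by (intro exI[of _ 1]) auto
    next
      case False
      then obtain c where c: "c \<in> C" "infdist x C = dist x c"
        using infdist_attains_inf[OF \<open>closed C\<close> False] by metis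
      have *: "\<rho> k < infdist x C"
      proof (rule ccontr)
        assume "\<not> \<rho> k < infdist x C"
        then have "dist x c \<le> \<rho> k" using c(2) by simp
        then show False using m(2) c(1) unfolding C_def by blast
      qed
      have "enat m \<le> H k y" if y: "y \<in> {0..1}" "dist y x < infdist x C - \<rho> k" for y
        unfolding H_ge[OF y(1)]
      proof (intro conjI ballI impI m(1))
        fix u :: real assume u: "u \<in> {0..1}" "dist y u \<le> \<rho> k"
        have "dist x u < infdist x C"
          using y(2) u(2) dist_triangle[of x u y] unfolding dist_commute[of x y] by linarith
        then have "u \<notin> C" using infdist_le[of u C x] by auto
        then show "enat m \<le> lsc_apply f u" using u(1) by (simp add: C_def)
      qed
      then show ?thesis using * by (intro exI[of _ "infdist x C - \<rho> k"]) auto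
    qed
  qed
  then have app: "lsc_apply (Abs_lsc01 (H k)) = H k" for k
    by (intro Abs_lsc01_inverse) (simp add: H_def)
  have "locally_between (Abs_lsc01 (H k)) (Abs_lsc01 (H (Suc k)))" for k
    unfolding locally_between_def app
  proof
    fix x :: real assume x: "x \<in> {0..1}"
    have "H (Suc k) x \<le> enat (Suc k)" using x by (simp add: H_def)
    then obtain m where m: "H (Suc k) x = enat m" by (cases "H (Suc k) x") auto
    have "H k y \<le> enat m" if y: "y \<in> {0..1}" "dist y x < \<rho> k - \<rho> (Suc k)" for y
    proof (rule enat_leI)
      fix i assume "enat i \<le> H k y"
      then have i: "i \<le> k" "\<forall>u\<in>{0..1}. dist y u \<le> \<rho> k \<longrightarrow> enat i \<le> lsc_apply f u"
        using y(1) by (auto simp: H_ge)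
      have "dist y u \<le> \<rho> k" if "dist x u \<le> \<rho> (Suc k)" for u
        using that y(2) dist_triangle[of y u x] by linarith
      then have "enat i \<le> H (Suc k) x"
        using i x by (auto simp: H_ge)
      then show "enat i \<le> enat m" by (simp add: m)
    qed
    then show "\<exists>m. enat m \<le> H (Suc k) x \<and> (\<exists>r>0. \<forall>y\<in>{0..1}. dist y x < r \<longrightarrow> H k y \<le> enat m)"
      using m \<rho>(2)[of k] by (intro exI[of _ m] conjI exI[of _ "\<rho> k - \<rho> (Suc k)"]) simp_all
  qed
  moreover have "is_seq_sup (\<lambda>k. Abs_lsc01 (H k)) f"
    unfolding lsc_is_seq_sup_iff app
  proof (intro allI antisym)
    fix x :: real
    show "(SUP k. H k x) \<le> lsc_apply f x"
    proof (rule SUP_least)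
      fix k
      show "H k x \<le> lsc_apply f x"
      proof (cases "x \<in> {0..1}")
        case True
        show ?thesis
        proof (rule enat_leI)
          fix m assume "enat m \<le> H k x"
          then show "enat m \<le> lsc_apply f x"
            using True \<rho>(1)[of k] by (simp add: H_ge less_imp_le)
        qed
      qed (auto simp: H_def)
    qed
    show "lsc_apply f x \<le> (SUP k. H k x)"
    proof (cases "x \<in> {0..1}")
      case True
      show ?thesis
      proof (rule enat_leI)
        fix m assume "enat m \<le> lsc_apply f x"
        then obtain r where r: "r > 0" "\<forall>y\<in>{0..1}. dist y x < r \<longrightarrow> enat m \<le> lsc_apply f y"
          using lsc_onD_fin[OF lsc_on_lsc_apply True] by blast
        obtain l where l: "\<rho> l < r"
          using nat_approx_posE[OF r(1)] unfolding \<rho>_def by metis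
        have "\<rho> (max l m) \<le> \<rho> l"
          unfolding \<rho>_def by (intro divide_left_mono) simp_all
        then have "enat m \<le> H (max l m) x"
          using r(2) l True by (auto simp: H_ge dist_commute)
        also have "\<dots> \<le> (SUP k. H k x)" by (rule SUP_upper) simp
        finally show "enat m \<le> (SUP k. H k x)" .
      qed
    qed (simp add: lsc_apply_outside)
  qed
  ultimately show ?thesis by (intro exI[of _ "\<lambda>k. Abs_lsc01 (H k)"]) simp
qed

lemma lsc_way_below_iff: "f \<lless> g \<longleftrightarrow> locally_between f g"
proof
  assume fg: "f \<lless> g"
  obtain h where h: "\<And>k. locally_between (h k) (h (Suc k))" "is_seq_sup h g"
    using lsc_approximation by blast
  have "incseq h" using h(1) by (intro incseq_SucI locally_between_imp_le)
  then obtain k where "f \<le> h k"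
    using fg h(2) unfolding way_below_def by blast
  moreover have "h (Suc k) \<le> g" using h(2) by (simp add: is_seq_sup_def)
  ultimately show "locally_between f g" using h(1) locally_between_mono by blast
qed (rule locally_between_imp_way_below)

instance lsc01 :: cu_semigroup
proof
  fix x :: lsc01
  show "0 \<le> x" by transfer simp
next
  fix z :: "nat \<Rightarrow> lsc01"
  show "\<exists>s. is_seq_sup z s" using lsc_SUP_exists by (simp add: lsc_is_seq_sup_iff)
next
  fix x :: lsc01
  show "\<exists>z. (\<forall>n. z n \<lless> z (Suc n)) \<and> is_seq_sup z x"
    using lsc_approximation by (simp add: lsc_way_below_iff)
next
  fix x' x y' y :: lsc01
  show "x' \<lless> x \<Longrightarrow> y' \<lless> y \<Longrightarrow> x' + y' \<lless> x + y"
    by (simp add: lsc_way_below_iff locally_between_add)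
next
  fix u v :: "nat \<Rightarrow> lsc01" and a b
  assume inc: "incseq u" "incseq v" and "is_seq_sup u a" "is_seq_sup v b"
  moreover have "incseq (\<lambda>n. lsc_apply (u n) x)" "incseq (\<lambda>n. lsc_apply (v n) x)" for x
    using inc by (auto simp: incseq_def lsc_le_iff)
  ultimately show "is_seq_sup (\<lambda>n. u n + v n) (a + b)"
    by (simp add: lsc_is_seq_sup_iff lsc_apply_plus enat_SUP_add)
qed

end

(*
  Since p is compact, weak cancellation and (O5) make p cancellable and give differences v - p
  for all v >= p. The chain is refined to elements x_t for t in a dense grid of [0,1], strictly
  decreasing in t with respect to way-below and continuous from the right. Each x_t has a canonical
  complement y_t in p, obtained as a supremum of (O5)-complements, such that x_t + y_t <= p and
  p <= x_t + y_u for t < u. The morphism sends the indicators of (t,1] and [0,t) to x_t and y_t,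
  and 1 to p. Every step function on the grid becomes a sum of such generators after adding a
  multiple of 1, so its image is determined by subtracting a multiple of p; the two inequalities
  above are exactly what makes this assignment monotone. Finally it is extended to all functions
  by suprema, step functions being a basis that is approximated from below by shifting end points.
*)
theory Submission
  imports Defs
begin

section \<open>Suprema and the way-below relation\<close>

text \<open>A Cu-morphism on \<open>lsc01\<close> must turn the indicator of [0,t) into a supremum
  over points u < t, so an arbitrary (O5)-complement of x_t in p cannot serve as y_t. Weak
  cancellation tames the choices: if p is compact and x + y <= p <= x + z, then y is way below z.
  Complements are thus ordered by the inequalities they satisfy, however they were picked, and a
  supremum of them works. Apart from multiples of p nothing can be subtracted in S, so expressions
  of a step function are not reduced to a normal form. Monotonicity of the assignment is proved
  directly, and well-definedness follows by using it in both directions. The multiples of p balance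
  there because (t,1] and [0,t) contain as many grid points as open cells, whereas [0,1] contains
  one point more. The denominators n 2^k make the prescribed points (n-k)/n the coarsest grid; only
  values between them are chosen.\<close>

lemma is_seq_sup_upper: "is_seq_sup z s \<Longrightarrow> z n \<le> s"
  by (simp add: is_seq_sup_def)

lemma is_seq_sup_least: "is_seq_sup z s \<Longrightarrow> (\<And>n. z n \<le> u) \<Longrightarrow> s \<le> u"
  by (simp add: is_seq_sup_def)

lemma is_seq_supI: "(\<And>n. z n \<le> s) \<Longrightarrow> (\<And>u. (\<And>n. z n \<le> u) \<Longrightarrow> s \<le> u) \<Longrightarrow> is_seq_sup z s"
  by (simp add: is_seq_sup_def)

lemma is_seq_sup_const: "is_seq_sup (\<lambda>_. x) x"
  by (simp add: is_seq_sup_def)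

lemma is_seq_sup_offset:
  assumes "incseq z"
  shows "is_seq_sup (\<lambda>i. z (i + m)) s \<longleftrightarrow> is_seq_sup z s"
proof -
  have "(\<forall>i. z (i + m) \<le> u) \<longleftrightarrow> (\<forall>i. z i \<le> u)" for u
  proof
    assume *: "\<forall>i. z (i + m) \<le> u"
    show "\<forall>i. z i \<le> u"
    proof
      fix i
      have "z i \<le> z (i + m)" using assms by (simp add: incseq_def)
      then show "z i \<le> u" using * order_trans by blast
    qed
  qed blast
  then show ?thesis unfolding is_seq_sup_def by simp
qed

lemma way_belowD:
  assumes "x \<lless> y" "incseq z" "is_seq_sup z s" "y \<le> s"
  shows "\<exists>n. x \<le> z n"
  using assms unfolding way_below_def by blast

lemma way_below_imp_le: "x \<lless> y \<Longrightarrow> x \<le> y"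
  using way_belowD[of x y "\<lambda>_. y" y] is_seq_sup_const by (auto simp: incseq_def)

lemma way_below_mono: "x' \<le> x \<Longrightarrow> x \<lless> y \<Longrightarrow> y \<le> y' \<Longrightarrow> x' \<lless> y'"
  unfolding way_below_def by (meson order_trans)

lemma zero_way_below: "0 \<lless> (x :: 'a :: cu_semigroup)"
  unfolding way_below_def using zero_least by blast

lemma way_below_interpolation:
  fixes x y :: "'a :: cu_semigroup"
  assumes "x \<lless> y"
  obtains z where "x \<lless> z" "z \<lless> y"
proof -
  obtain z where z: "\<And>n. z n \<lless> z (Suc n)" "is_seq_sup z y"
    using O2 by metis
  have "incseq z" using z(1) by (intro incseq_SucI way_below_imp_le)
  then obtain n where "x \<le> z n" using way_belowD assms z(2) by blast
  then have "x \<lless> z (Suc n)" using z(1) way_below_mono by blast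
  moreover have "z (Suc n) \<lless> y"
    using z(1) way_below_mono is_seq_sup_upper[OF z(2)] by blast
  ultimately show ?thesis using that by blast
qed

text \<open>\<open>H\<close> is a partial map in relational form, single-valued by
  \<open>mono\<close>. The morphism sends t to the least upper bound of the \<open>H\<close>-values
  below t. In \<open>approx\<close>, \<open>fs d \<lless> f\<close> makes this compatible with
  suprema, and \<open>vs d \<lless> v\<close> carries the way-below relation over.\<close>

theorem cu_morphism_extension:
  fixes H :: "'a::cu_semigroup \<Rightarrow> 'b::cu_semigroup \<Rightarrow> bool"
  assumes zero: "H 0 0"
    and add: "\<And>f v g w. H f v \<Longrightarrow> H g w \<Longrightarrow> H (f + g) (v + w)"
    and mono: "\<And>f v g w. H f v \<Longrightarrow> H g w \<Longrightarrow> f \<le> g \<Longrightarrow> v \<le> w"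
    and approx: "\<And>f v. H f v \<Longrightarrow> \<exists>fs vs. incseq fs \<and> (\<forall>d. H (fs d) (vs d) \<and> fs d \<lless> f \<and> vs d \<lless> v)
                   \<and> is_seq_sup fs f \<and> is_seq_sup vs v"
    and basis: "\<And>t. \<exists>fs vs. incseq fs \<and> (\<forall>d. H (fs d) (vs d)) \<and> is_seq_sup fs t"
  shows "\<exists>\<phi>. cu_morphism \<phi> \<and> (\<forall>f v. H f v \<longrightarrow> \<phi> f = v)"
proof -
  \<comment> \<open>\<open>f\<close> itself need not lie below any \<open>ts n\<close>, but each
    \<open>fs d\<close> does, and the \<open>vs d\<close> exhaust \<open>v\<close>.\<close>
  have key: "v \<le> w" if Hf: "H f v" and ts: "incseq ts" "is_seq_sup ts t" "f \<le> t"
    and bd: "\<And>n g u. H g u \<Longrightarrow> g \<le> ts n \<Longrightarrow> u \<le> w" for f v ts t w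
  proof -
    obtain fs vs where a: "\<And>d. H (fs d) (vs d)" "\<And>d. fs d \<lless> f" "is_seq_sup vs v"
      using approx[OF Hf] by metis
    show ?thesis
    proof (rule is_seq_sup_least[OF a(3)])
      fix d
      obtain n where "fs d \<le> ts n" using way_belowD[OF a(2) ts] by blast
      then show "vs d \<le> w" using bd a(1) by blast
    qed
  qed
  \<comment> \<open>Only increasing sequences are known to have suprema; by \<open>key\<close>, the
    supremum of the values along one basis sequence of \<open>t\<close> bounds all
    \<open>H\<close>-values below \<open>t\<close>.\<close>
  have "\<exists>w. (\<forall>f v. H f v \<longrightarrow> f \<le> t \<longrightarrow> v \<le> w) \<and>
            (\<forall>u. (\<forall>f v. H f v \<longrightarrow> f \<le> t \<longrightarrow> v \<le> u) \<longrightarrow> w \<le> u)" for t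
  proof -
    obtain fs vs where b: "incseq fs" "\<And>d. H (fs d) (vs d)" "is_seq_sup fs t"
      using basis by blast
    have "incseq vs" using b mono by (meson incseq_def)
    then obtain w where w: "is_seq_sup vs w" using O1 by blast
    have "v \<le> w" if "H f v" "f \<le> t" for f v
      using that(1) b(1,3) that(2)
    proof (rule key)
      show "u \<le> w" if "H g u" "g \<le> fs n" for n g u
        using mono[OF that(1) b(2) that(2)] is_seq_sup_upper[OF w] order_trans by blast
    qed
    moreover have "w \<le> u" if "\<forall>f v. H f v \<longrightarrow> f \<le> t \<longrightarrow> v \<le> u" for u
      using that b(2) is_seq_sup_upper[OF b(3)] by (intro is_seq_sup_least[OF w]) blast
    ultimately show ?thesis by blast
  qed
  then obtain \<phi> where ub: "\<And>t f v. H f v \<Longrightarrow> f \<le> t \<Longrightarrow> v \<le> \<phi> t"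
    and lub: "\<And>t u. (\<And>f v. H f v \<Longrightarrow> f \<le> t \<Longrightarrow> v \<le> u) \<Longrightarrow> \<phi> t \<le> u"
    by metis
  have ext: "\<phi> f = v" if "H f v" for f v
    using that ub lub mono by (meson order_antisym order_refl)
  have phi_mono: "\<phi> s \<le> \<phi> t" if "s \<le> t" for s t
    using lub ub order_trans[OF _ that] by blast
  have phi_sup: "is_seq_sup (\<lambda>n. \<phi> (ts n)) (\<phi> t)" if "incseq ts" "is_seq_sup ts t" for ts t
  proof (rule is_seq_supI)
    show "\<phi> (ts n) \<le> \<phi> t" for n
      using phi_mono is_seq_sup_upper[OF that(2)] by blast
    fix u assume u: "\<And>n. \<phi> (ts n) \<le> u"
    show "\<phi> t \<le> u"
    proof (rule lub)
      fix f v assume "H f v" "f \<le> t"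
      from this(1) that this(2) show "v \<le> u"
        by (rule key) (use ub u order_trans in blast)
    qed
  qed
  have "\<phi> (s + t) = \<phi> s + \<phi> t" for s t
  proof -
    obtain fs vs where b: "incseq fs" "\<And>d. H (fs d) (vs d)" "is_seq_sup fs s"
      using basis by blast
    obtain gs ws where c: "incseq gs" "\<And>d. H (gs d) (ws d)" "is_seq_sup gs t"
      using basis by blast
    have sup: "is_seq_sup vs (\<phi> s)" "is_seq_sup ws (\<phi> t)"
      using phi_sup[OF b(1,3)] phi_sup[OF c(1,3)] ext[OF b(2)] ext[OF c(2)] by simp_all
    have "incseq vs" "incseq ws" using b c mono by (meson incseq_def)+
    then have 1: "is_seq_sup (\<lambda>d. vs d + ws d) (\<phi> s + \<phi> t)"
      using sup O4 by blast
    have 2: "is_seq_sup (\<lambda>d. fs d + gs d) (s + t)"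
      using b c O4 by blast
    have 3: "incseq (\<lambda>d. fs d + gs d)"
      using b(1) c(1) by (auto simp: incseq_def intro: add_mono)
    show ?thesis
      using is_seq_sup_unique[OF phi_sup[OF 3 2]] 1 ext[OF add[OF b(2) c(2)]] by simp
  qed
  moreover have "\<phi> s \<lless> \<phi> t" if st: "s \<lless> t" for s t
  proof -
    \<comment> \<open>\<open>u\<close> leaves room for two approximations, \<open>fs d\<close> above
      \<open>u\<close> and then \<open>gs e\<close> above \<open>s\<close>, whose values satisfy
      \<open>ws e \<lless> vs d\<close>.\<close>
    obtain u where u: "s \<lless> u" "u \<lless> t" using way_below_interpolation[OF st] .
    obtain fs vs where b: "incseq fs" "\<And>d. H (fs d) (vs d)" "is_seq_sup fs t"
      using basis by blast
    obtain d where d: "u \<le> fs d" using way_belowD[OF u(2) b(1,3)] by blast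
    obtain gs ws where c: "incseq gs" "\<And>e. H (gs e) (ws e)" "\<And>e. ws e \<lless> vs d" "is_seq_sup gs (fs d)"
      using approx[OF b(2)] by blast
    obtain e where e: "s \<le> gs e" using way_belowD[OF u(1) c(1,4) d] by blast
    have "\<phi> s \<le> ws e" using phi_mono[OF e] ext[OF c(2)] by simp
    moreover have "vs d \<le> \<phi> t" using ub[OF b(2)] is_seq_sup_upper[OF b(3)] by blast
    ultimately show ?thesis using c(3) way_below_mono by blast
  qed
  ultimately have "cu_morphism \<phi>"
    unfolding cu_morphism_def using phi_mono phi_sup ext[OF zero] by blast
  then show ?thesis using ext by blast
qed

section \<open>Cancellation of a compact element\<close>

primrec nmul :: "nat \<Rightarrow> 'a::comm_monoid_add \<Rightarrow> 'a" where
  "nmul 0 x = 0"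
| "nmul (Suc m) x = nmul m x + x"

lemma nmul_add: "nmul (l + m) x = nmul l x + nmul m x"
  by (induction m) (simp_all add: algebra_simps)

lemma nmul_distrib: "nmul m (x + y) = nmul m x + nmul m y"
  by (induction m) (simp_all add: algebra_simps)

lemma nmul_zero: "nmul m 0 = 0"
  by (induction m) simp_all

lemma nmul_sum: "nmul (\<Sum>i\<in>A. m i) x = (\<Sum>i\<in>A. nmul (m i) x)"
  by (induction A rule: infinite_finite_induct) (simp_all add: nmul_add)

lemma nmul_mono: "x \<le> y \<Longrightarrow> nmul m x \<le> nmul m (y :: 'a :: ordered_comm_monoid_add)"
  by (induction m) (simp_all add: add_mono)

text \<open>Bundled as a property of one element so that the same subtraction arguments serve
  \<open>p\<close> in the target, where weak cancellation and (O5) provide them, and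
  \<open>1\<close> in \<open>lsc01\<close>, where they are checked pointwise.\<close>

definition cancellable :: "'a::cu_semigroup \<Rightarrow> bool" where
  "cancellable q \<longleftrightarrow> q \<lless> q \<and> (\<forall>u v. u + q \<le> v + q \<longrightarrow> u \<le> v) \<and>
     (\<forall>u v. u + q \<lless> v + q \<longrightarrow> u \<lless> v) \<and> (\<forall>v. q \<le> v \<longrightarrow> (\<exists>u. v = u + q))"

lemma cancellable_zero: "cancellable (0 :: 'a :: cu_semigroup)"
  by (simp add: cancellable_def zero_way_below)

lemma cancellable_add:
  assumes "cancellable p" "cancellable q"
  shows "cancellable (p + q)"
proof -
  have "u + (p + q) \<le> v + (p + q) \<Longrightarrow> u \<le> v" "u + (p + q) \<lless> v + (p + q) \<Longrightarrow> u \<lless> v" for u v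
    using assms unfolding cancellable_def by (metis add.assoc)+
  moreover have "\<exists>u. v = u + (p + q)" if v: "p + q \<le> v" for v
  proof -
    have "0 + q \<le> p + q" using zero_least by (rule add_right_mono)
    then have "q \<le> v" using v by simp
    then obtain u where u: "v = u + q" using assms unfolding cancellable_def by blast
    then have "p \<le> u" using v assms unfolding cancellable_def by blast
    then show ?thesis using assms u unfolding cancellable_def by (metis add.assoc)
  qed
  moreover have "p + q \<lless> p + q" using assms O3 unfolding cancellable_def by blast
  ultimately show ?thesis unfolding cancellable_def by blast
qed

lemma cancellable_nmul: "cancellable p \<Longrightarrow> cancellable (nmul m p)"
  by (induction m) (simp_all add: cancellable_zero cancellable_add)

lemma cancellable_way_below: "cancellable q \<Longrightarrow> q \<lless> q"
  and cancellable_le: "cancellable q \<Longrightarrow> u + q \<le> v + q \<Longrightarrow> u \<le> v"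
  and cancellable_way_belowD: "cancellable q \<Longrightarrow> u + q \<lless> v + q \<Longrightarrow> u \<lless> v"
  and cancellable_diff: "cancellable q \<Longrightarrow> q \<le> v \<Longrightarrow> \<exists>u. v = u + q"
  by (auto simp: cancellable_def)

lemma cancellable_seq_sup:
  assumes q: "cancellable q" and z: "incseq z" and sup: "is_seq_sup (\<lambda>d. z d + q) (s + q)"
  shows "is_seq_sup z s"
proof -
  obtain t where t: "is_seq_sup z t" using O1[OF z] by blast
  have "is_seq_sup (\<lambda>d. z d + q) (t + q)"
    using O4[OF z _ t is_seq_sup_const, of q] by (simp add: monotone_on_def)
  then have "t + q = s + q" using sup is_seq_sup_unique by blast
  then have "t = s" using cancellable_le[OF q] by (metis order_antisym order_refl)
  then show ?thesis using t by simp
qed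

text \<open>Weak cancellation speaks of the way-below relation only; cancellation for the order
  follows by applying it to each term of a way-below increasing sequence with supremum
  \<open>u\<close>.\<close>

lemma compact_cancellable:
  fixes p :: "'a :: {weakly_cancellative_cu_semigroup, cu_semigroup_O5}"
  assumes "compact_elem p"
  shows "cancellable p"
proof -
  have p: "p \<lless> p" using assms by (simp add: compact_elem_def)
  have le: "u \<le> v" if uv: "u + p \<le> v + p" for u v
  proof -
    obtain z where z: "\<And>n. z n \<lless> z (Suc n)" "is_seq_sup z u"
      using O2 by metis
    have "z n \<lless> v" for n
    proof (rule weak_cancellation)
      have "z n \<lless> u" using z(1) way_below_mono is_seq_sup_upper[OF z(2)] by blast
      then have "z n + p \<lless> u + p" using p O3 by blast
      then show "z n + p \<lless> v + p" using uv way_below_mono by blast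
    qed
    then show ?thesis by (intro is_seq_sup_least[OF z(2)] way_below_imp_le)
  qed
  have "\<exists>u. v = u + p" if v: "p \<le> v" for v
  proof -
    \<comment> \<open>Compactness allows \<open>x' = x = p\<close> in (O5), so that its two bounds
      involve the same \<open>p + c\<close>.\<close>
    obtain c where "p + c \<le> v" "v \<le> p + c"
      using O5[of p 0 v p 0] v p zero_way_below[of "0 :: 'a"] by auto
    then show ?thesis by (metis add.commute order_antisym)
  qed
  then show ?thesis
    unfolding cancellable_def using p le weak_cancellation by blast
qed

text \<open>Since \<open>p \<lless> p\<close>, the bounds give \<open>x + y \<lless> x + z\<close>,
  and weak cancellation removes \<open>x\<close>, which need not be compact.\<close>

lemma complement_way_below:
  fixes p :: "'a :: weakly_cancellative_cu_semigroup"
  assumes "compact_elem p" "x + y \<le> p" "p \<le> x + z"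
  shows "y \<lless> z"
proof (rule weak_cancellation)
  show "y + x \<lless> z + x"
    using assms way_below_mono by (simp add: compact_elem_def add.commute)
qed

section \<open>Combinations of grid generators\<close>

text \<open>
  The model case is \<open>p = 1\<close>, \<open>x i = \<chi>(t\<^sub>i,1]\<close>, \<open>y i = \<chi>[0,t\<^sub>i)\<close> for points \<open>t\<^sub>0 < \<dots> < t\<^sub>N\<close>.
\<close>

definition grid_comb ::
  "nat \<Rightarrow> 'a::comm_monoid_add \<Rightarrow> (nat \<Rightarrow> 'a) \<Rightarrow> (nat \<Rightarrow> 'a) \<Rightarrow> nat \<Rightarrow> (nat \<Rightarrow> nat) \<Rightarrow> (nat \<Rightarrow> nat) \<Rightarrow> 'a"
  where "grid_comb N p x y m \<alpha> \<beta> =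
    nmul m p + (\<Sum>i<N. nmul (\<alpha> i) (x i)) + (\<Sum>i<N. nmul (\<beta> i) (y (Suc i)))"

text \<open>In the model case, the value of the combination at the point \<open>t\<^sub>i\<close>.\<close>

definition grid_value :: "nat \<Rightarrow> nat \<Rightarrow> (nat \<Rightarrow> nat) \<Rightarrow> (nat \<Rightarrow> nat) \<Rightarrow> nat \<Rightarrow> nat"
  where "grid_value N m \<alpha> \<beta> i = m + (\<Sum>j<i. \<alpha> j) + (\<Sum>j\<in>{i..<N}. \<beta> j)"

text \<open>Both sides are the value on the open cell \<open>i\<close>, computed from its left and
  from its right end point.\<close>

lemma grid_value_Suc:
  "i < N \<Longrightarrow> grid_value N m \<alpha> \<beta> i + \<alpha> i = grid_value N m \<alpha> \<beta> (Suc i) + \<beta> i"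
  by (simp add: grid_value_def sum.atLeast_Suc_lessThan)

text \<open>An Euler characteristic count, points against open cells: half-open generators
  contribute equally to both, while \<open>1\<close> covers one point more.\<close>

lemma grid_value_total:
  "(\<Sum>i\<le>N. grid_value N m \<alpha> \<beta> i) = (\<Sum>i<N. grid_value N m \<alpha> \<beta> i + \<alpha> i) + m"
proof -
  have "(\<Sum>i\<le>N. grid_value N m \<alpha> \<beta> i)
      = grid_value N m \<alpha> \<beta> 0 + (\<Sum>i<N. grid_value N m \<alpha> \<beta> (Suc i))"
    by (rule sum.lessThan_Suc_shift[of "grid_value N m \<alpha> \<beta>" N, unfolded lessThan_Suc_atMost])
  also have "(\<Sum>i<N. grid_value N m \<alpha> \<beta> i + \<alpha> i)
      = (\<Sum>i<N. grid_value N m \<alpha> \<beta> (Suc i)) + (\<Sum>i<N. \<beta> i)"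
    by (simp add: grid_value_Suc flip: sum.distrib)
  ultimately show ?thesis
    by (simp add: grid_value_def atLeast0LessThan)
qed

text \<open>
  Filling up the open cells of the first function trades \<open>p\<close> for \<open>x i + y (i + 1) \<ge> p\<close>; then
  filling up the grid points trades \<open>x i + y i \<le> p\<close> for \<open>p\<close>. Since the monoid is not
  cancellative, all terms that would be subtracted are moved to the other side.
\<close>

lemma grid_comb_mono:
  fixes p :: "'a :: cu_semigroup"
  assumes p: "cancellable p" and ends: "x N = 0" "y 0 = 0"
    and le_p: "\<And>i. i \<le> N \<Longrightarrow> x i + y i \<le> p"
    and p_le: "\<And>i. i < N \<Longrightarrow> p \<le> x i + y (Suc i)"
    and c: "\<And>i. i \<le> N \<Longrightarrow> grid_value N m \<alpha> \<beta> i \<le> grid_value N m' \<alpha>' \<beta>' i"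
    and a: "\<And>i. i < N \<Longrightarrow> grid_value N m \<alpha> \<beta> i + \<alpha> i \<le> grid_value N m' \<alpha>' \<beta>' i + \<alpha>' i"
  shows "grid_comb N p x y m \<alpha> \<beta> \<le> grid_comb N p x y m' \<alpha>' \<beta>'"
proof -
  define c where "c = grid_value N m \<alpha> \<beta>"
  define c' where "c' = grid_value N m' \<alpha>' \<beta>'"
  define a where "a i = c i + \<alpha> i" for i
  define a' where "a' i = c' i + \<alpha>' i" for i
  have le: "\<And>i. i \<le> N \<Longrightarrow> c i \<le> c' i" "\<And>i. i < N \<Longrightarrow> a i \<le> a' i"
    using assms(6,7) by (simp_all add: c_def c'_def a_def a'_def)
  have aS: "\<And>i. i < N \<Longrightarrow> a i = c (Suc i) + \<beta> i" "\<And>i. i < N \<Longrightarrow> a' i = c' (Suc i) + \<beta>' i"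
    by (simp_all add: c_def c'_def a_def a'_def grid_value_Suc)
  define D where "D = (\<Sum>i<N. a' i - a i)"
  define E where "E = (\<Sum>i\<le>N. c' i - c i)"
  \<comment> \<open>\<open>nmul m p + W\<close> stands for the step function with the cell values
    \<open>a'\<close> of the second function and the point values \<open>c\<close> of the first,
    raised by the constant \<open>D\<close>.\<close>
  define W where "W = (\<Sum>i<N. nmul (a' i - c i) (x i)) + (\<Sum>i<N. nmul (a' i - c (Suc i)) (y (Suc i)))"
  have "(\<Sum>i<N. a i) + D = (\<Sum>i<N. a' i)" "(\<Sum>i\<le>N. c i) + E = (\<Sum>i\<le>N. c' i)"
    using le by (auto simp: D_def E_def simp flip: sum.distrib intro!: sum.cong)
  moreover have "(\<Sum>i\<le>N. c i) = (\<Sum>i<N. a i) + m" "(\<Sum>i\<le>N. c' i) = (\<Sum>i<N. a' i) + m'"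
    unfolding a_def a'_def c_def c'_def by (rule grid_value_total)+
  \<comment> \<open>Filling cells costs \<open>D\<close> copies of \<open>p\<close> and filling
    points costs \<open>E\<close>; this balance lets one and the same multiple of \<open>p\<close>
    be cancelled at the end.\<close>
  ultimately have DE: "D + m' = E + m" by linarith
  have "nmul D p \<le> (\<Sum>i<N. nmul (a' i - a i) (x i + y (Suc i)))"
    unfolding D_def nmul_sum by (intro sum_mono nmul_mono p_le) simp
  then have "grid_comb N p x y m \<alpha> \<beta> + nmul D p
      \<le> grid_comb N p x y m \<alpha> \<beta> + (\<Sum>i<N. nmul (a' i - a i) (x i + y (Suc i)))"
    by (rule add_left_mono)
  also have "\<dots> = nmul m p + ((\<Sum>i<N. nmul (\<alpha> i + (a' i - a i)) (x i))
      + (\<Sum>i<N. nmul (\<beta> i + (a' i - a i)) (y (Suc i))))"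
    by (simp add: grid_comb_def nmul_distrib nmul_add sum.distrib algebra_simps)
  also have "\<dots> = nmul m p + W"
    unfolding W_def
  proof (intro arg_cong2[where f = "(+)"] refl sum.cong arg_cong2[where f = nmul])
    fix i assume "i \<in> {..<N}"
    then show "\<alpha> i + (a' i - a i) = a' i - c i" "\<beta> i + (a' i - a i) = a' i - c (Suc i)"
      using le(2)[of i] aS(1)[of i] a_def[of i] by simp_all
  qed
  finally have 1: "grid_comb N p x y m \<alpha> \<beta> + nmul D p \<le> nmul m p + W" .
  have "nmul m' p + W = grid_comb N p x y m' \<alpha>' \<beta>'
      + ((\<Sum>i<N. nmul (c' i - c i) (x i)) + (\<Sum>i<N. nmul (c' (Suc i) - c (Suc i)) (y (Suc i))))"
  proof -
    have "W = (\<Sum>i<N. nmul (\<alpha>' i + (c' i - c i)) (x i))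
        + (\<Sum>i<N. nmul (\<beta>' i + (c' (Suc i) - c (Suc i))) (y (Suc i)))"
      unfolding W_def
    proof (intro arg_cong2[where f = "(+)"] refl sum.cong arg_cong2[where f = nmul])
      fix i assume "i \<in> {..<N}"
      then show "a' i - c i = \<alpha>' i + (c' i - c i)" "a' i - c (Suc i) = \<beta>' i + (c' (Suc i) - c (Suc i))"
        using le(1)[of i] le(1)[of "Suc i"] aS(2)[of i] a'_def[of i] by simp_all
    qed
    then show ?thesis
      by (simp add: grid_comb_def nmul_add sum.distrib algebra_simps)
  qed
  also have "(\<Sum>i<N. nmul (c' i - c i) (x i)) + (\<Sum>i<N. nmul (c' (Suc i) - c (Suc i)) (y (Suc i)))
      = (\<Sum>i\<le>N. nmul (c' i - c i) (x i)) + (\<Sum>i\<le>N. nmul (c' i - c i) (y i))"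
  proof -
    have "(\<Sum>i\<le>N. nmul (c' i - c i) (y i)) = (\<Sum>i<N. nmul (c' (Suc i) - c (Suc i)) (y (Suc i)))"
      using sum.lessThan_Suc_shift[of "\<lambda>i. nmul (c' i - c i) (y i)" N]
      by (simp add: ends nmul_zero lessThan_Suc_atMost)
    moreover have "(\<Sum>i\<le>N. nmul (c' i - c i) (x i)) = (\<Sum>i<N. nmul (c' i - c i) (x i))"
      by (simp add: ends nmul_zero flip: lessThan_Suc_atMost)
    ultimately show ?thesis by simp
  qed
  also have "\<dots> = (\<Sum>i\<le>N. nmul (c' i - c i) (x i + y i))"
    by (simp add: nmul_distrib sum.distrib)
  also have "grid_comb N p x y m' \<alpha>' \<beta>' + \<dots> \<le> grid_comb N p x y m' \<alpha>' \<beta>' + nmul E p"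
    unfolding E_def nmul_sum by (intro add_left_mono sum_mono nmul_mono le_p) simp
  finally have 2: "nmul m' p + W \<le> grid_comb N p x y m' \<alpha>' \<beta>' + nmul E p" .
  have "grid_comb N p x y m \<alpha> \<beta> + nmul (D + m') p
      = nmul m' p + (grid_comb N p x y m \<alpha> \<beta> + nmul D p)"
    by (simp add: nmul_add algebra_simps)
  also have "\<dots> \<le> nmul m' p + (nmul m p + W)" using 1 by (rule add_left_mono)
  also have "\<dots> = nmul m p + (nmul m' p + W)" by (simp add: algebra_simps)
  also have "\<dots> \<le> nmul m p + (grid_comb N p x y m' \<alpha>' \<beta>' + nmul E p)"
    using 2 by (rule add_left_mono)
  also have "\<dots> = grid_comb N p x y m' \<alpha>' \<beta>' + nmul (D + m') p"
    unfolding DE by (simp add: nmul_add algebra_simps)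
  finally show ?thesis
    by (rule cancellable_le[OF cancellable_nmul[OF p]])
qed

lemma grid_comb_add:
  "grid_comb N p x y m \<alpha> \<beta> + grid_comb N p x y m' \<alpha>' \<beta>'
     = grid_comb N p x y (m + m') (\<lambda>i. \<alpha> i + \<alpha>' i) (\<lambda>i. \<beta> i + \<beta>' i)"
  by (simp add: grid_comb_def nmul_add sum.distrib algebra_simps)

lemma grid_comb_unit: "grid_comb N p x y (Suc 0) (\<lambda>_. 0) (\<lambda>_. 0) = p"
  by (simp add: grid_comb_def)

lemma grid_comb_zero: "grid_comb N p x y 0 (\<lambda>_. 0) (\<lambda>_. 0) = 0"
  by (simp add: grid_comb_def)

lemma grid_comb_left:
  assumes "i < N"
  shows "grid_comb N p x y 0 (\<lambda>j. if j = i then 1 else 0) (\<lambda>_. 0) = x i"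
proof -
  have "(\<Sum>j<N. nmul (if j = i then 1 else 0) (x j)) = (\<Sum>j<N. if j = i then x j else 0)"
    by (intro sum.cong) auto
  then show ?thesis using assms by (simp add: grid_comb_def)
qed

lemma grid_comb_right:
  assumes "i < N"
  shows "grid_comb N p x y 0 (\<lambda>_. 0) (\<lambda>j. if j = i then 1 else 0) = y (Suc i)"
proof -
  have "(\<Sum>j<N. nmul (if j = i then 1 else 0) (y (Suc j))) = (\<Sum>j<N. if j = i then y (Suc j) else 0)"
    by (intro sum.cong) auto
  then show ?thesis using assms by (simp add: grid_comb_def)
qed

section \<open>Half-open intervals in the unit interval\<close>

definition chi_above :: "real \<Rightarrow> lsc01" where "chi_above t = lsc_indicator {t<..1}"

definition chi_below :: "real \<Rightarrow> lsc01" where "chi_below t = lsc_indicator {0..<t}"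

lemma lsc_apply_chi_above: "0 \<le> t \<Longrightarrow> lsc_apply (chi_above t) x = (if t < x \<and> x \<le> 1 then 1 else 0)"
  by (simp add: chi_above_def lsc_apply_indicator openin_unit_interval_upper indicator_def)

lemma lsc_apply_chi_below:
  assumes "t \<le> 1"
  shows "lsc_apply (chi_below t) x = (if 0 \<le> x \<and> x < t then 1 else 0)"
proof -
  have "{0..<t} = {0..1} \<inter> {..<t}" using assms by auto
  then have "openin (top_of_set {0..1}) {0..<t}" by (metis open_lessThan openin_open_Int)
  then show ?thesis by (simp add: chi_below_def lsc_apply_indicator indicator_def)
qed

lemma lsc_apply_zero: "lsc_apply 0 x = 0"
  by (simp add: zero_lsc01.rep_eq)

lemma lsc_apply_one: "lsc_apply 1 x = (if x \<in> {0..1} then 1 else 0)"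
  by (simp add: one_lsc01.rep_eq)

lemma lsc_apply_nmul: "lsc_apply (nmul m f) x = of_nat m * lsc_apply f x"
  by (induction m) (simp_all add: lsc_apply_zero lsc_apply_plus algebra_simps)

lemma lsc_apply_sum: "lsc_apply (\<Sum>i\<in>A. f i) x = (\<Sum>i\<in>A. lsc_apply (f i) x)"
  by (induction A rule: infinite_finite_induct) (simp_all add: lsc_apply_zero lsc_apply_plus)

lemma chi_above_way_below:
  assumes "0 \<le> t" "t < u"
  shows "chi_above u \<lless> chi_above t"
proof -
  have "\<exists>m. enat m \<le> lsc_apply (chi_above t) x \<and>
      (\<exists>r>0. \<forall>y\<in>{0..1}. dist y x < r \<longrightarrow> lsc_apply (chi_above u) y \<le> enat m)"
    if "x \<in> {0..1}" for x
  proof (cases "t < x")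
    case True
    then show ?thesis using assms that
      by (intro exI[of _ 1] conjI exI[of _ "1 :: real"]) (auto simp: lsc_apply_chi_above one_enat_def)
  next
    case False
    then show ?thesis using assms that
      by (intro exI[of _ 0] conjI exI[of _ "u - t"])
        (auto simp: lsc_apply_chi_above dist_real_def zero_enat_def[symmetric])
  qed
  then show ?thesis by (simp add: lsc_way_below_iff locally_between_def)
qed

lemma chi_below_way_below:
  assumes "t < u" "u \<le> 1"
  shows "chi_below t \<lless> chi_below u"
proof -
  have "\<exists>m. enat m \<le> lsc_apply (chi_below u) x \<and>
      (\<exists>r>0. \<forall>y\<in>{0..1}. dist y x < r \<longrightarrow> lsc_apply (chi_below t) y \<le> enat m)"
    if "x \<in> {0..1}" for x
  proof (cases "x < u")
    case True
    then show ?thesis using assms that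
      by (intro exI[of _ 1] conjI exI[of _ "1 :: real"]) (auto simp: lsc_apply_chi_below one_enat_def)
  next
    case False
    then show ?thesis using assms that
      by (intro exI[of _ 0] conjI exI[of _ "u - t"])
        (auto simp: lsc_apply_chi_below dist_real_def zero_enat_def[symmetric])
  qed
  then show ?thesis by (simp add: lsc_way_below_iff locally_between_def)
qed

lemma SUP_of_bool_enat:
  "(SUP d. if P d then 1 else 0 :: enat) = (if \<exists>d. P d then 1 else 0)"
proof (cases "\<exists>d. P d")
  case True
  then obtain d where "P d" ..
  then have "(1 :: enat) \<le> (SUP d. if P d then 1 else 0)" by (intro SUP_upper2[of d]) auto
  moreover have "(SUP d. if P d then 1 else 0 :: enat) \<le> 1" by (rule SUP_least) auto
  ultimately show ?thesis using True by (simp add: antisym)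
qed simp

lemma chi_above_is_seq_sup:
  assumes "0 \<le> t" "\<And>d. t < u d" "u \<longlonglongrightarrow> t"
  shows "is_seq_sup (\<lambda>d. chi_above (u d)) (chi_above t)"
proof -
  have "(\<exists>d. u d < x) \<longleftrightarrow> t < x" for x
  proof
    show "\<exists>d. u d < x \<Longrightarrow> t < x" using assms(2) less_trans by blast
    show "\<exists>d. u d < x" if "t < x"
      using order_tendstoD(2)[OF assms(3) that] eventually_sequentially by auto
  qed
  moreover have "0 \<le> u d" for d using assms(1) assms(2)[of d] by simp
  ultimately show ?thesis
    using assms(1) by (simp only: lsc_is_seq_sup_iff lsc_apply_chi_above SUP_of_bool_enat) auto
qed

lemma chi_below_is_seq_sup:
  assumes "t \<le> 1" "\<And>d. u d < t" "u \<longlonglongrightarrow> t"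
  shows "is_seq_sup (\<lambda>d. chi_below (u d)) (chi_below t)"
proof -
  have "(\<exists>d. x < u d) \<longleftrightarrow> x < t" for x
  proof
    show "\<exists>d. x < u d \<Longrightarrow> x < t" using assms(2) less_trans by blast
    show "\<exists>d. x < u d" if "x < t"
      using order_tendstoD(1)[OF assms(3) that] eventually_sequentially by auto
  qed
  moreover have "u d \<le> 1" for d using assms(1) assms(2)[of d] by simp
  ultimately show ?thesis
    using assms(1) by (simp only: lsc_is_seq_sup_iff lsc_apply_chi_below SUP_of_bool_enat) auto
qed

text \<open>Subtracting 1 pointwise is harmless at infinity, and the finite bounds in
  \<open>locally_between\<close> and in lower semicontinuity just drop by one.\<close>

lemma cancellable_one_lsc: "cancellable (1 :: lsc01)"
proof -
  have "locally_between 1 1"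
    unfolding locally_between_def
    by (auto simp: lsc_apply_one one_enat_def intro!: exI[of _ 1] exI[of _ "1 :: real"])
  moreover have "u \<le> v" if "u + 1 \<le> v + 1" for u v :: lsc01
    unfolding lsc_le_iff_on
  proof
    fix x :: real assume "x \<in> {0..1}"
    then have "lsc_apply u x + 1 \<le> lsc_apply v x + 1"
      using that unfolding lsc_le_iff by (metis lsc_apply_plus lsc_apply_one)
    then show "lsc_apply u x \<le> lsc_apply v x"
      by (cases "lsc_apply u x"; cases "lsc_apply v x") (simp_all add: one_enat_def)
  qed
  moreover have "locally_between u v" if uv: "locally_between (u + 1) (v + 1)" for u v
    unfolding locally_between_def
  proof
    fix x :: real assume x: "x \<in> {0..1}"
    then obtain m r where m: "enat m \<le> lsc_apply v x + 1" "r > 0"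
      "\<And>y. y \<in> {0..1} \<Longrightarrow> dist y x < r \<Longrightarrow> lsc_apply u y + 1 \<le> enat m"
      using uv unfolding locally_between_def lsc_apply_plus lsc_apply_one by force
    have "lsc_apply u x + 1 \<le> enat m" using m x by simp
    then obtain l where l: "m = Suc l"
      by (cases m; cases "lsc_apply u x") (auto simp: one_enat_def)
    have *: "a + 1 \<le> enat m \<longleftrightarrow> a \<le> enat l" "enat m \<le> a + 1 \<longleftrightarrow> enat l \<le> a" for a
      by (cases a; simp add: l one_enat_def)+
    show "\<exists>m. enat m \<le> lsc_apply v x \<and>
        (\<exists>r>0. \<forall>y\<in>{0..1}. dist y x < r \<longrightarrow> lsc_apply u y \<le> enat m)"
      using m unfolding * by blast
  qed
  moreover have "\<exists>u. v = u + 1" if v: "1 \<le> v" for v :: lsc01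
  proof -
    have ge1: "1 \<le> lsc_apply v x" if "x \<in> {0..1}" for x
      using v that unfolding lsc_le_iff by (metis lsc_apply_one)
    have *: "enat m \<le> a - 1 \<longleftrightarrow> enat (Suc m) \<le> a" if "1 \<le> a" for m a
      using that by (cases a) (auto simp: one_enat_def)
    have "lsc_on {0..1} (\<lambda>x. lsc_apply v x - 1)"
    proof (rule lsc_on_finI)
      fix x :: real and m assume x: "x \<in> {0..1}" and m: "enat m \<le> lsc_apply v x - 1"
      have "enat (Suc m) \<le> lsc_apply v x" using * ge1 x m by blast
      from lsc_onD_fin[OF lsc_on_lsc_apply x this]
      show "\<exists>r>0. \<forall>y\<in>{0..1}. dist y x < r \<longrightarrow> enat m \<le> lsc_apply v y - 1"
        using * ge1 by metis
    qed
    then have "lsc_apply (Abs_lsc01 (\<lambda>x. lsc_apply v x - 1)) = (\<lambda>x. lsc_apply v x - 1)"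
      by (intro Abs_lsc01_inverse) (simp add: lsc_apply_outside)
    moreover have "a - 1 + 1 = a" if "1 \<le> a" for a :: enat
      using that by (cases a) (auto simp: one_enat_def)
    ultimately have "lsc_apply v x = lsc_apply (Abs_lsc01 (\<lambda>x. lsc_apply v x - 1) + 1) x" for x
      using ge1 by (auto simp: lsc_apply_plus lsc_apply_one lsc_apply_outside)
    then show ?thesis by (metis lsc_apply_inject ext)
  qed
  ultimately show ?thesis by (simp add: cancellable_def lsc_way_below_iff)
qed

lemma lsc_apply_grid_comb:
  assumes "x \<in> {0..1}"
  shows "lsc_apply (grid_comb N 1 (\<lambda>i. chi_above (real i / real N)) (\<lambda>i. chi_below (real i / real N)) m \<alpha> \<beta>) x
    = enat (m + (\<Sum>i<N. if real i / real N < x then \<alpha> i else 0)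
              + (\<Sum>i<N. if x < real (Suc i) / real N then \<beta> i else 0))"
proof -
  have sum_enat: "(\<Sum>i<N. enat (h i)) = enat (\<Sum>i<N. h i)" for h
    by (induction N) (simp_all add: zero_enat_def)
  have "(\<Sum>i<N. of_nat (\<alpha> i) * lsc_apply (chi_above (real i / real N)) x)
      = (\<Sum>i<N. enat (if real i / real N < x then \<alpha> i else 0))"
    using assms by (intro sum.cong) (auto simp: lsc_apply_chi_above of_nat_eq_enat zero_enat_def)
  moreover have "(\<Sum>i<N. of_nat (\<beta> i) * lsc_apply (chi_below (real (Suc i) / real N)) x)
      = (\<Sum>i<N. enat (if x < real (Suc i) / real N then \<beta> i else 0))"
  proof (intro sum.cong refl)
    fix i assume "i \<in> {..<N}"
    then have "real (Suc i) / real N \<le> 1" by (simp add: divide_le_eq)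
    then show "of_nat (\<beta> i) * lsc_apply (chi_below (real (Suc i) / real N)) x
        = enat (if x < real (Suc i) / real N then \<beta> i else 0)"
      using assms by (auto simp: lsc_apply_chi_below of_nat_eq_enat zero_enat_def)
  qed
  ultimately show ?thesis
    using assms
    by (simp only: grid_comb_def lsc_apply_plus lsc_apply_nmul lsc_apply_sum lsc_apply_one sum_enat)
      (simp add: of_nat_eq_enat)
qed

lemma lsc_apply_grid_comb_point:
  assumes "i \<le> N" "N > 0"
  shows "lsc_apply (grid_comb N 1 (\<lambda>i. chi_above (real i / real N)) (\<lambda>i. chi_below (real i / real N)) m \<alpha> \<beta>)
      (real i / real N) = enat (grid_value N m \<alpha> \<beta> i)"
proof -
  have "(\<Sum>j<N. if real j / real N < real i / real N then \<alpha> j else 0) = (\<Sum>j<i. \<alpha> j)"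
    using assms by (intro sum.mono_neutral_cong_right) (auto simp: divide_less_cancel)
  moreover have "(\<Sum>j<N. if real i / real N < real (Suc j) / real N then \<beta> j else 0) = (\<Sum>j\<in>{i..<N}. \<beta> j)"
    using assms by (intro sum.mono_neutral_cong_right) (auto simp: divide_less_cancel)
  moreover have "real i / real N \<in> {0..1}" using assms by (simp add: divide_le_eq)
  ultimately show ?thesis by (simp only: lsc_apply_grid_comb grid_value_def)
qed

lemma lsc_apply_grid_comb_cell:
  assumes "i < N" "real i / real N < x" "x < real (Suc i) / real N"
  shows "lsc_apply (grid_comb N 1 (\<lambda>i. chi_above (real i / real N)) (\<lambda>i. chi_below (real i / real N)) m \<alpha> \<beta>)
      x = enat (grid_value N m \<alpha> \<beta> i + \<alpha> i)"
proof -
  have N: "real N > 0" using assms(1) by simp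
  have x: "real i < x * real N" "x * real N < real (Suc i)"
    using assms N by (simp_all add: field_simps)
  have *: "real j / real N < x \<longleftrightarrow> j \<le> i" "x < real (Suc j) / real N \<longleftrightarrow> i \<le> j" for j
  proof -
    have "real j < x * real N \<longleftrightarrow> j \<le> i" "x * real N < real (Suc j) \<longleftrightarrow> i \<le> j"
      using x by linarith+
    then show "real j / real N < x \<longleftrightarrow> j \<le> i" "x < real (Suc j) / real N \<longleftrightarrow> i \<le> j"
      using N by (simp_all add: divide_less_eq less_divide_eq)
  qed
  have "(\<Sum>j<N. if j \<le> i then \<alpha> j else 0) = (\<Sum>j\<le>i. \<alpha> j)"
    using assms by (intro sum.mono_neutral_cong_right) auto
  also have "\<dots> = (\<Sum>j<i. \<alpha> j) + \<alpha> i" by (simp flip: lessThan_Suc_atMost)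
  finally have 1: "(\<Sum>j<N. if j \<le> i then \<alpha> j else 0) = (\<Sum>j<i. \<alpha> j) + \<alpha> i" .
  have 2: "(\<Sum>j<N. if i \<le> j then \<beta> j else 0) = (\<Sum>j\<in>{i..<N}. \<beta> j)"
    by (intro sum.mono_neutral_cong_right) auto
  have "0 \<le> real i / real N" "real (Suc i) / real N \<le> 1" using assms(1) by (simp_all add: divide_le_eq)
  then have "x \<in> {0..1}" using assms(2,3) unfolding atLeastAtMost_iff by linarith
  then show ?thesis by (simp only: lsc_apply_grid_comb * 1 2) (simp add: grid_value_def)
qed

lemma cell_midpoint:
  assumes "N > 0"
  shows "real i / real N < (real i + 1/2) / real N" "(real i + 1/2) / real N < real (Suc i) / real N"
  using assms by (simp_all add: divide_strict_right_mono)

section \<open>Morphisms from systems of generators\<close>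

definition grid_point :: "nat \<Rightarrow> nat \<Rightarrow> nat \<Rightarrow> real" where
  "grid_point n k i = real i / real (n * 2 ^ k)"

lemma grid_point_refine: "grid_point n (k + d) (2 ^ d * i) = grid_point n k i"
  by (simp add: grid_point_def power_add field_simps)

lemma iterate_double:
  fixes f :: "nat \<Rightarrow> nat \<Rightarrow> 'a"
  assumes "\<And>k i. f (Suc k) (2 * i) = f k i"
  shows "f (k + d) (2 ^ d * i) = f k i"
proof (induction d)
  case (Suc d)
  show ?case using assms[of "k + d" "2 ^ d * i"] Suc by (simp add: mult.assoc)
qed simp

lemma tendsto_divide_power2: "(\<lambda>d. c / (a * 2 ^ (k + Suc d)) :: real) \<longlonglongrightarrow> 0"
proof -
  have "(\<lambda>d. c / (a * 2 ^ Suc k) * (1 / 2) ^ d) \<longlonglongrightarrow> c / (a * 2 ^ Suc k) * 0"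
    by (intro tendsto_intros LIMSEQ_power_zero) simp
  then show ?thesis by (simp add: power_add power_divide field_simps)
qed

text \<open>
  The elements \<open>X k i\<close> and \<open>Y k i\<close> are the prospective images of the indicator functions of
  \<open>(t,1]\<close> and \<open>[0,t)\<close> for \<open>t = i / (n 2\<^sup>k)\<close>, and \<open>p\<close> is that of \<open>1\<close>.
\<close>

locale generator_system =
  fixes n :: nat
    and p :: "'a :: cu_semigroup"
    and X Y :: "nat \<Rightarrow> nat \<Rightarrow> 'a"
  assumes n_pos: "n > 0"
    and p: "cancellable p"
    and X_double: "X (Suc k) (2 * i) = X k i"
    and Y_double: "Y (Suc k) (2 * i) = Y k i"
    and X_end: "X k (n * 2 ^ k) = 0"
    and Y_0: "Y k 0 = 0"
    and le_p: "i \<le> n * 2 ^ k \<Longrightarrow> X k i + Y k i \<le> p"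
    and p_le: "i < n * 2 ^ k \<Longrightarrow> p \<le> X k i + Y k (Suc i)"
    and X_way_below: "X k (Suc i) \<lless> X k i"
    and Y_way_below: "i < n * 2 ^ k \<Longrightarrow> Y k i \<lless> Y k (Suc i)"
    and X_sup: "i < n * 2 ^ k \<Longrightarrow> is_seq_sup (\<lambda>d. X (k + Suc d) (2 ^ Suc d * i + 1)) (X k i)"
    and Y_sup: "0 < i \<Longrightarrow> i \<le> n * 2 ^ k \<Longrightarrow> is_seq_sup (\<lambda>d. Y (k + Suc d) (2 ^ Suc d * i - 1)) (Y k i)"
begin

text \<open>A relation, because one function has many expressions by generators; it is single-valued
  by \<open>generated_mono\<close>. The end points omitted in \<open>left\<close> and
  \<open>right\<close> are those with an empty interval.\<close>

inductive generated :: "lsc01 \<Rightarrow> 'a \<Rightarrow> bool" where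
  zero: "generated 0 0"
| unit: "generated 1 p"
| left: "i < n * 2 ^ k \<Longrightarrow> generated (chi_above (grid_point n k i)) (X k i)"
| right: "0 < i \<Longrightarrow> i \<le> n * 2 ^ k \<Longrightarrow> generated (chi_below (grid_point n k i)) (Y k i)"
| add: "generated f v \<Longrightarrow> generated g w \<Longrightarrow> generated (f + g) (v + w)"

lemmas X_refine = iterate_double[of X, OF X_double]

lemmas Y_refine = iterate_double[of Y, OF Y_double]

section \<open>Combinations at a fixed level and their comparison\<close>

definition source_comb :: "nat \<Rightarrow> nat \<Rightarrow> (nat \<Rightarrow> nat) \<Rightarrow> (nat \<Rightarrow> nat) \<Rightarrow> lsc01" where
  "source_comb k = grid_comb (n * 2 ^ k) 1 (\<lambda>i. chi_above (real i / real (n * 2 ^ k))) (\<lambda>i. chi_below (real i / real (n * 2 ^ k)))"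

definition target_comb :: "nat \<Rightarrow> nat \<Rightarrow> (nat \<Rightarrow> nat) \<Rightarrow> (nat \<Rightarrow> nat) \<Rightarrow> 'a" where
  "target_comb k = grid_comb (n * 2 ^ k) p (X k) (Y k)"

text \<open>Both functions are constant on open cells, so evaluating them at grid points and cell
  midpoints gives exactly the hypotheses of \<open>grid_comb_mono\<close>.\<close>

lemma comb_mono:
  assumes "source_comb k m \<alpha> \<beta> \<le> source_comb k m' \<alpha>' \<beta>'"
  shows "target_comb k m \<alpha> \<beta> \<le> target_comb k m' \<alpha>' \<beta>'"
proof -
  let ?N = "n * 2 ^ k"
  have N: "?N > 0" using n_pos by simp
  have le: "lsc_apply (source_comb k m \<alpha> \<beta>) x \<le> lsc_apply (source_comb k m' \<alpha>' \<beta>') x" for x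
    using assms by (simp add: lsc_le_iff)
  have "grid_value ?N m \<alpha> \<beta> i \<le> grid_value ?N m' \<alpha>' \<beta>' i" if "i \<le> ?N" for i
    using le[of "real i / real ?N"] that N by (simp only: source_comb_def lsc_apply_grid_comb_point enat_ord_simps)
  moreover have "grid_value ?N m \<alpha> \<beta> i + \<alpha> i \<le> grid_value ?N m' \<alpha>' \<beta>' i + \<alpha>' i" if "i < ?N" for i
    using le[of "(real i + 1/2) / real ?N"]
      lsc_apply_grid_comb_cell[OF that cell_midpoint[OF N, of i]]
    by (simp only: source_comb_def enat_ord_simps)
  ultimately show ?thesis
    unfolding target_comb_def using X_end Y_0 le_p p_le by (intro grid_comb_mono[OF p]) simp_all
qed

text \<open>Asking for all sufficiently fine levels, not just one, allows the summands in the case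
  \<open>add\<close>, and later two functions to be compared, to be put on a common grid.\<close>

lemma generated_comb_at_level:
  assumes "generated f v"
  shows "\<exists>k0. \<forall>k\<ge>k0. \<exists>m \<alpha> \<beta>. f = source_comb k m \<alpha> \<beta> \<and> v = target_comb k m \<alpha> \<beta>"
  using assms
proof induction
  case zero
  then show ?case unfolding source_comb_def target_comb_def using grid_comb_zero by metis
next
  case unit
  then show ?case unfolding source_comb_def target_comb_def using grid_comb_unit by metis
next
  case (left i k)
  show ?case
  proof (rule exI[of _ k], intro allI impI)
    fix l assume "k \<le> l"
    then obtain d where l: "l = k + d" using le_Suc_ex by blast
    have i: "2 ^ d * i < n * 2 ^ l" using left by (simp add: l power_add)
    let ?\<alpha> = "\<lambda>j. if j = 2 ^ d * i then 1 else 0"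
    have "chi_above (grid_point n k i) = source_comb l 0 ?\<alpha> (\<lambda>_. 0)"
      unfolding source_comb_def grid_comb_left[OF i]
      using grid_point_refine[of n k d i] by (simp add: l grid_point_def)
    moreover have "X k i = target_comb l 0 ?\<alpha> (\<lambda>_. 0)"
      unfolding target_comb_def grid_comb_left[OF i] using X_refine[of k d i] by (simp add: l)
    ultimately show "\<exists>m \<alpha> \<beta>. chi_above (grid_point n k i) = source_comb l m \<alpha> \<beta> \<and> X k i = target_comb l m \<alpha> \<beta>"
      by blast
  qed
next
  case (right i k)
  show ?case
  proof (rule exI[of _ k], intro allI impI)
    fix l assume "k \<le> l"
    then obtain d where l: "l = k + d" using le_Suc_ex by blast
    have "0 < 2 ^ d * i" using right by simp
    \<comment> \<open>\<open>grid_comb\<close> reaches the right generators through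
      \<open>y (Suc j)\<close>, hence the predecessor.\<close>
    then obtain j where j: "2 ^ d * i = Suc j" using gr0_implies_Suc by blast
    have "2 ^ d * i \<le> n * 2 ^ l" using right by (simp add: l power_add)
    then have i: "j < n * 2 ^ l" by (simp add: j)
    let ?\<beta> = "\<lambda>j'. if j' = j then 1 else 0"
    have "chi_below (grid_point n k i) = source_comb l 0 (\<lambda>_. 0) ?\<beta>"
      unfolding source_comb_def grid_comb_right[OF i]
      using grid_point_refine[of n k d i] by (simp only: l grid_point_def j)
    moreover have "Y k i = target_comb l 0 (\<lambda>_. 0) ?\<beta>"
      unfolding target_comb_def grid_comb_right[OF i] using Y_refine[of k d i] by (simp only: l j)
    ultimately show "\<exists>m \<alpha> \<beta>. chi_below (grid_point n k i) = source_comb l m \<alpha> \<beta> \<and> Y k i = target_comb l m \<alpha> \<beta>"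
      by blast
  qed
next
  case (add f v g w)
  then obtain k1 k2 where k: "\<And>k. k \<ge> k1 \<Longrightarrow> \<exists>m \<alpha> \<beta>. f = source_comb k m \<alpha> \<beta> \<and> v = target_comb k m \<alpha> \<beta>"
    "\<And>k. k \<ge> k2 \<Longrightarrow> \<exists>m \<alpha> \<beta>. g = source_comb k m \<alpha> \<beta> \<and> w = target_comb k m \<alpha> \<beta>"
    by blast
  show ?case
  proof (rule exI[of _ "max k1 k2"], intro allI impI)
    fix k assume "max k1 k2 \<le> k"
    then obtain m \<alpha> \<beta> m' \<alpha>' \<beta>' where "f = source_comb k m \<alpha> \<beta>" "v = target_comb k m \<alpha> \<beta>"
      "g = source_comb k m' \<alpha>' \<beta>'" "w = target_comb k m' \<alpha>' \<beta>'"
      using k(1)[of k] k(2)[of k] by auto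
    then have "f + g = source_comb k (m + m') (\<lambda>i. \<alpha> i + \<alpha>' i) (\<lambda>i. \<beta> i + \<beta>' i)"
      "v + w = target_comb k (m + m') (\<lambda>i. \<alpha> i + \<alpha>' i) (\<lambda>i. \<beta> i + \<beta>' i)"
      by (simp_all only: source_comb_def target_comb_def grid_comb_add)
    then show "\<exists>m \<alpha> \<beta>. f + g = source_comb k m \<alpha> \<beta> \<and> v + w = target_comb k m \<alpha> \<beta>"
      by blast
  qed
qed

lemma generated_mono:
  assumes "generated f v" "generated g w" "f \<le> g"
  shows "v \<le> w"
proof -
  obtain k1 k2 where k: "\<And>k. k \<ge> k1 \<Longrightarrow> \<exists>m \<alpha> \<beta>. f = source_comb k m \<alpha> \<beta> \<and> v = target_comb k m \<alpha> \<beta>"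
    "\<And>k. k \<ge> k2 \<Longrightarrow> \<exists>m \<alpha> \<beta>. g = source_comb k m \<alpha> \<beta> \<and> w = target_comb k m \<alpha> \<beta>"
    using generated_comb_at_level[OF assms(1)] generated_comb_at_level[OF assms(2)] by blast
  from k(1)[of "max k1 k2"] k(2)[of "max k1 k2"] show ?thesis
    using comb_mono assms(3) by fastforce
qed

lemma generated_approx:
  assumes "generated f v"
  shows "\<exists>fs vs. incseq fs \<and> (\<forall>d. generated (fs d) (vs d) \<and> fs d \<lless> f \<and> vs d \<lless> v)
           \<and> is_seq_sup fs f \<and> is_seq_sup vs v"
  using assms
proof induction
  case zero
  show ?case
    by (intro exI[of _ "\<lambda>_. 0"]) (simp add: incseq_def zero_way_below is_seq_sup_const generated.zero)
next
  case unit
  show ?case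
    by (intro exI[of _ "\<lambda>_. 1"] exI[of _ "\<lambda>_. p"])
      (simp add: incseq_def is_seq_sup_const generated.unit cancellable_way_below p cancellable_one_lsc)
next
  case (left i k)
  \<comment> \<open>One grid step at level \<open>k + Suc d\<close>: the shifted end point is again
    a grid point, and it is the one in \<open>X_sup\<close>.\<close>
  define \<delta> where "\<delta> d = 1 / (real n * 2 ^ (k + Suc d))" for d
  have \<delta>: "0 < \<delta> d" "\<delta> (Suc d) < \<delta> d" for d
    using n_pos by (simp_all add: \<delta>_def field_simps)
  have pt: "grid_point n (k + Suc d) (2 ^ Suc d * i + 1) = grid_point n k i + \<delta> d" for d
    using grid_point_refine[of n k "Suc d" i]
    by (simp add: grid_point_def \<delta>_def add_divide_distrib)
  have pos: "0 \<le> grid_point n k i" by (simp add: grid_point_def)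
  have less: "2 ^ Suc d * i + 1 < n * 2 ^ (k + Suc d)" for d
  proof -
    have "2 ^ Suc d * i + 2 ^ Suc d \<le> 2 ^ Suc d * (n * 2 ^ k)"
      using left mult_le_mono2[of "Suc i" "n * 2 ^ k" "2 ^ Suc d"] by (simp add: algebra_simps)
    moreover have "(2::nat) \<le> 2 ^ Suc d" by simp
    moreover have "2 ^ Suc d * (n * 2 ^ k) = n * 2 ^ (k + Suc d)" by (simp add: power_add)
    ultimately show ?thesis by linarith
  qed
  let ?fs = "\<lambda>d. chi_above (grid_point n k i + \<delta> d)"
  let ?vs = "\<lambda>d. X (k + Suc d) (2 ^ Suc d * i + 1)"
  have "incseq ?fs"
    using chi_above_way_below \<delta> pos by (intro incseq_SucI way_below_imp_le) (simp add: add_nonneg_pos less_imp_le)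
  moreover have "generated (?fs d) (?vs d)" for d
    using generated.left[OF less[of d]] by (simp only: pt)
  moreover have "?fs d \<lless> chi_above (grid_point n k i)" for d
    using chi_above_way_below \<delta> pos by simp
  moreover have "?vs d \<lless> X k i" for d
    using X_way_below[of "k + Suc d" "2 ^ Suc d * i"] by (simp only: X_refine Suc_eq_plus1)
  moreover have "\<delta> \<longlonglongrightarrow> 0"
    using tendsto_divide_power2[of 1 "real n" k] by (simp add: \<delta>_def[abs_def])
  then have "(\<lambda>d. grid_point n k i + \<delta> d) \<longlonglongrightarrow> grid_point n k i"
    using tendsto_add[OF tendsto_const] by fastforce
  then have "is_seq_sup ?fs (chi_above (grid_point n k i))"
    using \<delta> pos by (intro chi_above_is_seq_sup) simp_all
  ultimately show ?case using X_sup[OF left] by (intro exI[of _ ?fs] exI[of _ ?vs] conjI allI)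
next
  case (right i k)
  define \<delta> where "\<delta> d = 1 / (real n * 2 ^ (k + Suc d))" for d
  have \<delta>: "0 < \<delta> d" "\<delta> (Suc d) < \<delta> d" for d
    using n_pos by (simp_all add: \<delta>_def field_simps)
  have ge: "2 \<le> 2 ^ Suc d * i" for d
  proof -
    have "(2::nat) ^ Suc d * 1 \<le> 2 ^ Suc d * i" using right by (intro mult_le_mono2) simp
    moreover have "(2::nat) \<le> 2 ^ Suc d" by simp
    ultimately show ?thesis by linarith
  qed
  have pt: "grid_point n (k + Suc d) (2 ^ Suc d * i - 1) = grid_point n k i - \<delta> d" for d
  proof -
    have "real (2 ^ Suc d * i - 1) = real (2 ^ Suc d * i) - 1" using ge[of d] by (simp add: of_nat_diff)
    then show ?thesis
      using grid_point_refine[of n k "Suc d" i]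
      by (simp add: grid_point_def \<delta>_def diff_divide_distrib)
  qed
  have "real i \<le> real (n * 2 ^ k)" using right(2) by (simp only: of_nat_le_iff)
  then have le1: "grid_point n k i \<le> 1"
    using n_pos by (simp add: grid_point_def divide_le_eq)
  have le: "2 ^ Suc d * i \<le> n * 2 ^ (k + Suc d)" for d
    using right mult_le_mono2[of "i" "n * 2 ^ k" "2 ^ Suc d"] by (simp add: power_add)
  let ?fs = "\<lambda>d. chi_below (grid_point n k i - \<delta> d)"
  let ?vs = "\<lambda>d. Y (k + Suc d) (2 ^ Suc d * i - 1)"
  have "incseq ?fs"
    using chi_below_way_below \<delta> le1 by (intro incseq_SucI way_below_imp_le) (simp add: diff_le_eq add_increasing2 less_imp_le)
  moreover have "generated (?fs d) (?vs d)" for d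
    using generated.right[of "2 ^ Suc d * i - 1" "k + Suc d"] ge[of d] le[of d] unfolding pt by linarith
  moreover have "?fs d \<lless> chi_below (grid_point n k i)" for d
    using chi_below_way_below \<delta> le1 by simp
  moreover have "?vs d \<lless> Y k i" for d
  proof -
    have "Suc (2 ^ Suc d * i - 1) = 2 ^ Suc d * i" "2 ^ Suc d * i - 1 < n * 2 ^ (k + Suc d)"
      using ge[of d] le[of d] by linarith+
    then show ?thesis
      using Y_way_below[of "2 ^ Suc d * i - 1" "k + Suc d"] by (simp only: Y_refine)
  qed
  moreover have "\<delta> \<longlonglongrightarrow> 0"
    using tendsto_divide_power2[of 1 "real n" k] by (simp add: \<delta>_def[abs_def])
  then have "(\<lambda>d. grid_point n k i - \<delta> d) \<longlonglongrightarrow> grid_point n k i"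
    using tendsto_diff[OF tendsto_const] by fastforce
  then have "is_seq_sup ?fs (chi_below (grid_point n k i))"
    using \<delta> le1 by (intro chi_below_is_seq_sup) simp_all
  ultimately show ?case using Y_sup[OF right] by (intro exI[of _ ?fs] exI[of _ ?vs] conjI allI)
next
  case (add f v g w)
  obtain fs vs where f: "incseq fs" "\<And>d. generated (fs d) (vs d)" "\<And>d. fs d \<lless> f" "\<And>d. vs d \<lless> v"
    "is_seq_sup fs f" "is_seq_sup vs v"
    using add.IH(1) by blast
  obtain gs ws where g: "incseq gs" "\<And>d. generated (gs d) (ws d)" "\<And>d. gs d \<lless> g" "\<And>d. ws d \<lless> w"
    "is_seq_sup gs g" "is_seq_sup ws w"
    using add.IH(2) by blast
  have inc: "incseq vs" "incseq ws" using f(1,2) g(1,2) generated_mono by (meson incseq_def)+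
  have "incseq (\<lambda>d. fs d + gs d)"
    using f(1) g(1) by (auto simp: incseq_def intro: add_mono)
  moreover have "is_seq_sup (\<lambda>d. fs d + gs d) (f + g)" "is_seq_sup (\<lambda>d. vs d + ws d) (v + w)"
    using O4 f g inc by blast+
  ultimately show ?case
    using generated.add[OF f(2) g(2)] O3[OF f(3) g(3)] O3[OF f(4) g(4)]
    by (intro exI[of _ "\<lambda>d. fs d + gs d"] exI[of _ "\<lambda>d. vs d + ws d"]) blast
qed

text \<open>
  Step functions in general are only generated up to subtracting multiples of \<open>1\<close>: for instance,
  \<open>\<chi>(a,b) + 1 = \<chi>(a,1] + \<chi>[0,b)\<close> if \<open>a < b\<close>.
\<close>

definition realised :: "lsc01 \<Rightarrow> 'a \<Rightarrow> bool" where
  "realised f v \<longleftrightarrow> (\<exists>l. generated (f + nmul l 1) (v + nmul l p))"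

lemma generated_nmul: "generated f v \<Longrightarrow> generated (nmul l f) (nmul l v)"
  by (induction l) (auto intro: generated.zero generated.add)

lemma generated_sum: "(\<And>i. i \<in> A \<Longrightarrow> generated (f i) (v i)) \<Longrightarrow> generated (\<Sum>i\<in>A. f i) (\<Sum>i\<in>A. v i)"
  by (induction A rule: infinite_finite_induct) (auto intro: generated.zero generated.add)

lemma generated_comb: "generated (source_comb k m \<alpha> \<beta>) (target_comb k m \<alpha> \<beta>)"
proof -
  have "generated (chi_above (real i / real (n * 2 ^ k))) (X k i)" if "i < n * 2 ^ k" for i
    using generated.left[OF that] by (simp only: grid_point_def)
  moreover have "generated (chi_below (real (Suc i) / real (n * 2 ^ k))) (Y k (Suc i))" if "i < n * 2 ^ k" for i
    using generated.right[of "Suc i" k] that by (simp only: grid_point_def)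
  ultimately show ?thesis
    unfolding source_comb_def target_comb_def grid_comb_def
    by (intro generated.add generated_sum generated_nmul generated.unit) simp_all
qed

lemma generated_imp_H: "generated f v \<Longrightarrow> realised f v"
  unfolding realised_def by (rule exI[of _ 0]) simp

lemma realised_add:
  assumes "realised f v" "realised g w"
  shows "realised (f + g) (v + w)"
proof -
  obtain l m where "generated (f + nmul l 1) (v + nmul l p)" "generated (g + nmul m 1) (w + nmul m p)"
    using assms unfolding realised_def by blast
  from generated.add[OF this] have "generated (f + g + nmul (l + m) 1) (v + w + nmul (l + m) p)"
    by (simp add: nmul_add algebra_simps)
  then show ?thesis unfolding realised_def ..
qed

lemma realised_mono:
  assumes "realised f v" "realised g w" "f \<le> g"
  shows "v \<le> w"
proof -
  obtain l m where lm: "generated (f + nmul l 1) (v + nmul l p)" "generated (g + nmul m 1) (w + nmul m p)"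
    using assms unfolding realised_def by blast
  \<comment> \<open>Each side receives the multiple of \<open>1\<close> that belongs to the other,
    so both carry the surplus \<open>l + m\<close>.\<close>
  have "f + nmul l 1 + nmul m 1 \<le> g + nmul m 1 + nmul l 1"
    using add_right_mono[OF assms(3), of "nmul l 1 + nmul m 1"] by (simp add: algebra_simps)
  from generated_mono[OF generated.add[OF lm(1) generated_nmul[OF generated.unit]] generated.add[OF lm(2) generated_nmul[OF generated.unit]] this]
  have "v + nmul (l + m) p \<le> w + nmul (l + m) p"
    by (simp add: nmul_add algebra_simps)
  then show ?thesis by (rule cancellable_le[OF cancellable_nmul[OF p]])
qed

text \<open>Approximate \<open>f + nmul l 1\<close> instead. Being compact, \<open>nmul l 1\<close>
  lies below the approximants from some index \<open>d0\<close> on, so it can be subtracted from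
  that tail, and \<open>nmul l p\<close> from the corresponding values.\<close>

lemma realised_approx:
  assumes "realised f v"
  shows "\<exists>fs vs. incseq fs \<and> (\<forall>d. realised (fs d) (vs d) \<and> fs d \<lless> f \<and> vs d \<lless> v)
           \<and> is_seq_sup fs f \<and> is_seq_sup vs v"
proof -
  obtain l where l: "generated (f + nmul l 1) (v + nmul l p)"
    using assms unfolding realised_def by blast
  have c: "cancellable (nmul l p)" "cancellable (nmul l (1 :: lsc01))"
    by (intro cancellable_nmul p cancellable_one_lsc)+
  obtain gs ws where g: "incseq gs" "\<And>d. generated (gs d) (ws d)" "\<And>d. gs d \<lless> f + nmul l 1"
    "\<And>d. ws d \<lless> v + nmul l p" "is_seq_sup gs (f + nmul l 1)" "is_seq_sup ws (v + nmul l p)"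
    using generated_approx[OF l] by blast
  have "nmul l 1 \<le> f + nmul l 1"
    using add_right_mono[OF zero_least, of "nmul l 1" f] by simp
  then obtain d0 where d0: "nmul l 1 \<le> gs d0"
    using way_belowD[OF cancellable_way_below[OF c(2)] g(1,5)] by blast
  have le1: "nmul l 1 \<le> gs (d + d0)" for d
    using d0 g(1) by (meson incseqD le_add2 order_trans)
  have le2: "nmul l p \<le> ws (d + d0)" for d
    using generated_mono[OF generated_nmul[OF generated.unit] g(2) le1] .
  obtain fs where fs: "\<And>d. gs (d + d0) = fs d + nmul l 1"
    using cancellable_diff[OF c(2) le1] by metis
  obtain vs where vs: "\<And>d. ws (d + d0) = vs d + nmul l p"
    using cancellable_diff[OF c(1) le2] by metis
  have "incseq ws" using g(1,2) generated_mono by (meson incseq_def)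
  then have incs: "incseq (\<lambda>d. fs d + nmul l 1)" "incseq (\<lambda>d. vs d + nmul l p)"
    using g(1) by (simp_all add: incseq_def flip: fs vs)
  have inc: "incseq fs" "incseq vs"
    using incs c unfolding incseq_def by (meson cancellable_le)+
  have sup: "is_seq_sup fs f" "is_seq_sup vs v"
    using cancellable_seq_sup[OF c(2) inc(1)] cancellable_seq_sup[OF c(1) inc(2)]
      is_seq_sup_offset[OF g(1), of d0] is_seq_sup_offset[OF \<open>incseq ws\<close>, of d0] g(5,6)
    by (simp_all add: fs vs)
  have "realised (fs d) (vs d) \<and> fs d \<lless> f \<and> vs d \<lless> v" for d
    using g(2)[of "d + d0"] cancellable_way_belowD[OF c(2)] g(3)[of "d + d0"]
      cancellable_way_belowD[OF c(1)] g(4)[of "d + d0"]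
    unfolding fs vs realised_def by blast
  then show ?thesis using inc sup by blast
qed

end

section \<open>Approximation by step functions\<close>

lemma unit_interval_grid_cases:
  assumes "x \<in> {0..1}" "N > 0"
  obtains (point) i where "i \<le> N" "x = real i / real N"
  | (cell) i where "i < N" "real i / real N < x" "x < real (Suc i) / real N"
proof -
  have N: "real N > 0" using assms by simp
  define i where "i = nat \<lfloor>x * real N\<rfloor>"
  have "0 \<le> x * real N" using assms by simp
  then have i: "real i \<le> x * real N" "x * real N < real (Suc i)"
    unfolding i_def by linarith+
  have "x * real N \<le> real N" using assms by simp
  then have "i \<le> N" using i by linarith
  show ?thesis
  proof (cases "real i = x * real N")
    case True
    then show ?thesis using N by (intro point[OF \<open>i \<le> N\<close>]) (simp add: field_simps)
  next
    case False
    then have "real i < x * real N" using i by simp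
    moreover from this have "i < N" using \<open>x * real N \<le> real N\<close> by linarith
    ultimately show ?thesis using i(2) N by (intro cell[of i]) (simp_all add: field_simps)
  qed
qed

lemma cell_eqI:
  assumes "N > 0" "real i / real N < x" "x < real (Suc i) / real N"
    and "real j / real N \<le> x" "x \<le> real (Suc j) / real N"
  shows "j = i"
proof -
  have "real i < x * real N" "x * real N < real (Suc i)" "real j \<le> x * real N" "x * real N \<le> real (Suc j)"
    using assms by (simp_all add: field_simps)
  then show ?thesis by linarith
qed

text \<open>Cells are closed, so the star of a grid point contains all adjacent cells; infima over
  stars can therefore only drop at grid points, as lower semicontinuity demands.\<close>

definition cell_star :: "nat \<Rightarrow> real \<Rightarrow> real set" where
  "cell_star N x = (\<Union>i\<in>{i. i < N \<and> x \<in> {real i / real N..real (Suc i) / real N}}.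
     {real i / real N..real (Suc i) / real N})"

text \<open>The cap \<open>k\<close> keeps the values finite, so that they yield natural number
  coefficients; it disappears in the supremum over \<open>k\<close>.\<close>

definition cell_inf :: "nat \<Rightarrow> nat \<Rightarrow> lsc01 \<Rightarrow> real \<Rightarrow> enat" where
  "cell_inf k N f x = min (enat k) (INF y\<in>cell_star N x. lsc_apply f y)"

lemma enat_le_cell_inf_iff:
  "enat m \<le> cell_inf k N f x \<longleftrightarrow> m \<le> k \<and> (\<forall>y\<in>cell_star N x. enat m \<le> lsc_apply f y)"
  by (simp add: cell_inf_def le_INF_iff)

lemma enat_the_enat_cell_inf: "enat (the_enat (cell_inf k N f x)) = cell_inf k N f x"
proof -
  have "cell_inf k N f x \<le> enat k" by (simp add: cell_inf_def)
  then show ?thesis by (cases "cell_inf k N f x") auto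
qed

lemma cell_inf_mono:
  assumes "k \<le> k'" "cell_star N' x' \<subseteq> cell_star N x"
  shows "cell_inf k N f x \<le> cell_inf k' N' f x'"
  proof (rule enat_leI)
  show "enat m \<le> cell_inf k N f x \<Longrightarrow> enat m \<le> cell_inf k' N' f x'" for m
    using assms by (auto simp: enat_le_cell_inf_iff)
qed

lemma cell_star_cell:
  assumes "i < N" "real i / real N < x" "x < real (Suc i) / real N"
  shows "cell_star N x = {real i / real N..real (Suc i) / real N}"
proof -
  have "{j. j < N \<and> x \<in> {real j / real N..real (Suc j) / real N}} = {i}"
    (is "?J = _")
  proof (rule antisym)
    show "?J \<subseteq> {i}"
    proof
      fix j assume "j \<in> ?J"
      then have "j = i" using assms by (intro cell_eqI[of N i x j]) simp_all
      then show "j \<in> {i}" by simp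
    qed
    show "{i} \<subseteq> ?J" using assms by simp
  qed
  then show ?thesis by (simp add: cell_star_def)
qed

lemma cell_subset_cell_star:
  assumes "i < N" "x \<in> {real i / real N..real (Suc i) / real N}"
  shows "{real i / real N..real (Suc i) / real N} \<subseteq> cell_star N x"
proof -
  have "i \<in> {i. i < N \<and> x \<in> {real i / real N..real (Suc i) / real N}}" using assms by simp
  then show ?thesis unfolding cell_star_def by (rule UN_upper)
qed

lemma cell_star_double: "cell_star (N * 2) x \<subseteq> cell_star N x"
proof
  fix y assume "y \<in> cell_star (N * 2) x"
  then obtain j where j: "j < N * 2" "x \<in> {real j / real (N * 2)..real (Suc j) / real (N * 2)}"
    "y \<in> {real j / real (N * 2)..real (Suc j) / real (N * 2)}"
    unfolding cell_star_def by blast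
  define i where "i = j div 2"
  have "2 * i \<le> j" "Suc j \<le> 2 * Suc i" unfolding i_def by presburger+
  then have ij: "real (2 * i) \<le> real j" "real (Suc j) \<le> real (2 * Suc i)"
    by (simp_all only: of_nat_le_iff)
  have N: "real N > 0" using j(1) by simp
  have "real i / real N = real (2 * i) / real (N * 2)" "real (Suc i) / real N = real (2 * Suc i) / real (N * 2)"
    using N by (simp_all add: field_simps)
  then have "real i / real N \<le> real j / real (N * 2)" "real (Suc j) / real (N * 2) \<le> real (Suc i) / real N"
    using ij by (simp_all only: divide_right_mono of_nat_0_le_iff)
  then have "{real j / real (N * 2)..real (Suc j) / real (N * 2)} \<subseteq> {real i / real N..real (Suc i) / real N}"
    by simp
  moreover have "i < N" using j(1) by (simp add: i_def)
  ultimately show "y \<in> cell_star N x"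
    using cell_subset_cell_star[of i N x] j(2,3) by blast
qed

lemma cell_star_dist:
  assumes "y \<in> cell_star N x"
  shows "y \<in> {0..1}" "dist y x \<le> 1 / real N"
proof -
  obtain i where i: "i < N" "x \<in> {real i / real N..real (Suc i) / real N}"
    "y \<in> {real i / real N..real (Suc i) / real N}"
    using assms unfolding cell_star_def by blast
  have "0 \<le> real i / real N" "real (Suc i) / real N \<le> 1" using i(1) by (simp_all add: divide_le_eq)
  then show "y \<in> {0..1}" using i(3) unfolding atLeastAtMost_iff by linarith
  have "real (Suc i) / real N = real i / real N + 1 / real N" by (simp add: add_divide_distrib)
  then show "dist y x \<le> 1 / real N"
    using i(2,3) unfolding atLeastAtMost_iff dist_real_def by linarith
qed

lemma mem_cell_star:
  assumes "x \<in> {0..1}" "N > 0"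
  shows "x \<in> cell_star N x"
  using assms
proof (cases rule: unit_interval_grid_cases)
  case (point i)
  have *: "real j / real N \<le> real (Suc j) / real N" for j by (simp add: divide_right_mono)
  show ?thesis
  proof (cases "i < N")
    case True
    have "x \<in> {real i / real N..real (Suc i) / real N}" using point * by simp
    then show ?thesis using cell_subset_cell_star[OF True] by blast
  next
    case False
    then have i: "i = Suc (N - 1)" "N - 1 < N" using point assms(2) by simp_all
    have "x \<in> {real (N - 1) / real N..real (Suc (N - 1)) / real N}"
      using point(2) * unfolding i(1) by simp
    then show ?thesis using cell_subset_cell_star[OF i(2)] by blast
  qed
next
  case (cell i)
  then have "x \<in> {real i / real N..real (Suc i) / real N}" by simp
  then show ?thesis using cell_subset_cell_star[OF cell(1)] by blast
qed

section \<open>Step functions on the grid are realised and form a basis\<close>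

context generator_system
begin

text \<open>The hypotheses express lower semicontinuity: the jump up after a grid point and the jump
  down before the next one are nonnegative, and they become the coefficients of the
  generators.\<close>

lemma realised_step_function:
  assumes "\<And>i. i < n * 2 ^ k \<Longrightarrow> c i \<le> a i" "\<And>i. i < n * 2 ^ k \<Longrightarrow> c (Suc i) \<le> a i"
  shows "\<exists>g v. realised g v \<and>
    (\<forall>i \<le> n * 2 ^ k. lsc_apply g (real i / real (n * 2 ^ k)) = enat (c i)) \<and>
    (\<forall>i < n * 2 ^ k. \<forall>x. real i / real (n * 2 ^ k) < x \<longrightarrow> x < real (Suc i) / real (n * 2 ^ k)
        \<longrightarrow> lsc_apply g x = enat (a i))"
proof -
  define N where "N = n * 2 ^ k"
  have N: "N > 0" using n_pos by (simp add: N_def)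
  have le: "\<And>i. i < N \<Longrightarrow> c i \<le> a i" "\<And>i. i < N \<Longrightarrow> c (Suc i) \<le> a i"
    using assms by (simp_all add: N_def)
  define \<alpha> where "\<alpha> i = a i - c i" for i
  define \<beta> where "\<beta> i = a i - c (Suc i)" for i
  \<comment> \<open>A jump down at t subtracts the indicator of [t,1]; using that of [0,t) instead
    adds a constant each time, in total \<open>l\<close>.\<close>
  define l where "l = (\<Sum>i<N. \<beta> i)"
  let ?f = "source_comb k (c 0) \<alpha> \<beta>"
  have val: "grid_value N (c 0) \<alpha> \<beta> i = c i + l" if "i \<le> N" for i
    using that
  proof (induction i)
    case 0
    show ?case by (simp add: grid_value_def l_def atLeast0LessThan)
  next
    case (Suc i)
    have "c i + \<alpha> i = a i" "c (Suc i) + \<beta> i = a i" using le[of i] Suc by (simp_all add: \<alpha>_def \<beta>_def)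
    moreover have "grid_value N (c 0) \<alpha> \<beta> i + \<alpha> i = grid_value N (c 0) \<alpha> \<beta> (Suc i) + \<beta> i"
      by (rule grid_value_Suc) (use Suc in simp)
    moreover have "grid_value N (c 0) \<alpha> \<beta> i = c i + l" using Suc by simp
    ultimately show ?case by linarith
  qed
  have f_point: "lsc_apply ?f (real i / real N) = enat (c i) + enat l" if "i \<le> N" for i
    using lsc_apply_grid_comb_point[OF that N] val[OF that] by (simp add: source_comb_def N_def)
  have f_cell: "lsc_apply ?f x = enat (a i) + enat l"
    if "i < N" "real i / real N < x" "x < real (Suc i) / real N" for i x
  proof -
    have "grid_value N (c 0) \<alpha> \<beta> i + \<alpha> i = a i + l" using val[of i] le(1) that by (simp add: \<alpha>_def)
    then show ?thesis
      using lsc_apply_grid_comb_cell[OF that, of "c 0" \<alpha> \<beta>] unfolding source_comb_def N_def by simp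
  qed
  have l1: "lsc_apply (nmul l 1) x = enat l" if "x \<in> {0..1}" for x
    using that by (simp add: lsc_apply_nmul lsc_apply_one of_nat_eq_enat)
  have "nmul l 1 \<le> ?f"
    unfolding lsc_le_iff_on
  proof
    fix x :: real assume x: "x \<in> {0..1}"
    from this N show "lsc_apply (nmul l 1) x \<le> lsc_apply ?f x"
    proof (cases rule: unit_interval_grid_cases)
      case (point i)
      show ?thesis unfolding l1[OF x] unfolding point(2) f_point[OF point(1)] by simp
    next
      case (cell i)
      show ?thesis unfolding l1[OF x] f_cell[OF cell] by simp
    qed
  qed
  then obtain g where g: "?f = g + nmul l 1"
    using cancellable_diff[OF cancellable_nmul[OF cancellable_one_lsc]] by blast
  have "nmul l p \<le> target_comb k (c 0) \<alpha> \<beta>"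
    using generated_mono[OF generated_nmul[OF generated.unit] generated_comb \<open>nmul l 1 \<le> ?f\<close>] .
  then obtain v where v: "target_comb k (c 0) \<alpha> \<beta> = v + nmul l p"
    using cancellable_diff[OF cancellable_nmul[OF p]] by blast
  have "realised g v" unfolding realised_def using generated_comb[of k "c 0" \<alpha> \<beta>] unfolding g v by blast
  have gx: "lsc_apply g x = enat b" if "x \<in> {0..1}" "lsc_apply ?f x = enat b + enat l" for x b
    using that(2) unfolding g lsc_apply_plus l1[OF that(1)] by (cases "lsc_apply g x") simp_all
  have in01: "i \<le> N \<Longrightarrow> real i / real N \<in> {0..1}" for i using N by (simp add: divide_le_eq)
  have "lsc_apply g (real i / real N) = enat (c i)" if "i \<le> N" for i
    using gx in01 f_point that by blast
  moreover have "lsc_apply g x = enat (a i)"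
    if "i < N" "real i / real N < x" "x < real (Suc i) / real N" for i x
  proof -
    have "x \<in> {0..1}" using in01[of i] in01[of "Suc i"] that unfolding atLeastAtMost_iff by linarith
    then show ?thesis using gx f_cell that by blast
  qed
  ultimately show ?thesis
    using \<open>realised g v\<close> unfolding N_def[symmetric] by (intro exI[of _ g] exI[of _ v]) simp
qed

lemma realised_cell_inf: "\<exists>g v. realised g v \<and> (\<forall>x\<in>{0..1}. lsc_apply g x = cell_inf k (n * 2 ^ k) f x)"
proof -
  define N where "N = n * 2 ^ k"
  have N: "N > 0" using n_pos by (simp add: N_def)
  define c where "c i = the_enat (cell_inf k N f (real i / real N))" for i
  \<comment> \<open>The star of an interior point of a cell is that closed cell, so the midpoint
    represents all of them.\<close>
  define a where "a i = the_enat (cell_inf k N f ((real i + 1/2) / real N))" for i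
  have c: "enat (c i) = cell_inf k N f (real i / real N)" for i
    by (simp add: c_def enat_the_enat_cell_inf)
  have a: "enat (a i) = cell_inf k N f x"
    if "i < N" "real i / real N < x" "x < real (Suc i) / real N" for i x
    using cell_star_cell[OF that] cell_star_cell[OF that(1) cell_midpoint[OF N, of i]]
    by (simp only: a_def enat_the_enat_cell_inf) (simp only: cell_inf_def)
  have mono: "real i / real N \<le> real (Suc i) / real N" for i
    by (simp add: divide_right_mono)
  have "c i \<le> a i" "c (Suc i) \<le> a i" if i: "i < N" for i
  proof -
    have "cell_star N ((real i + 1/2) / real N) \<subseteq> cell_star N x"
      if "x \<in> {real i / real N..real (Suc i) / real N}" for x
      using cell_subset_cell_star[OF i that] cell_star_cell[OF i cell_midpoint[OF N, of i]] by simp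
    then have "enat (c i) \<le> enat (a i)" "enat (c (Suc i)) \<le> enat (a i)"
      unfolding c a[OF i cell_midpoint[OF N, of i]] using mono
      by (intro cell_inf_mono; simp)+
    then show "c i \<le> a i" "c (Suc i) \<le> a i" by simp_all
  qed
  then obtain g v where g: "realised g v" "\<And>i. i \<le> N \<Longrightarrow> lsc_apply g (real i / real N) = enat (c i)"
    "\<And>i x. i < N \<Longrightarrow> real i / real N < x \<Longrightarrow> x < real (Suc i) / real N \<Longrightarrow> lsc_apply g x = enat (a i)"
    using realised_step_function[of k c a, folded N_def] by metis
  have "lsc_apply g x = cell_inf k N f x" if "x \<in> {0..1}" for x
    using that N
  proof (cases rule: unit_interval_grid_cases)
    case (point i)
    then show ?thesis using g(2) c by simp
  next
    case (cell i)
    then show ?thesis using g(3) a by simp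
  qed
  then show ?thesis using g(1) unfolding N_def by blast
qed

lemma realised_basis: "\<exists>fs vs. incseq fs \<and> (\<forall>k. realised (fs k) (vs k)) \<and> is_seq_sup fs f"
proof -
  obtain fs vs where realised: "\<And>k. realised (fs k) (vs k)"
    and fs: "\<And>k x. x \<in> {0..1} \<Longrightarrow> lsc_apply (fs k) x = cell_inf k (n * 2 ^ k) f x"
    using realised_cell_inf[of _ f] by metis
  have "incseq fs"
  proof (rule incseq_SucI)
    fix k
    show "fs k \<le> fs (Suc k)"
      unfolding lsc_le_iff_on
    proof
      fix x :: real assume x: "x \<in> {0..1}"
      have "cell_star (n * 2 ^ Suc k) x \<subseteq> cell_star (n * 2 ^ k) x"
        using cell_star_double[of "n * 2 ^ k" x] by (simp add: ac_simps)
      then show "lsc_apply (fs k) x \<le> lsc_apply (fs (Suc k)) x"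
        unfolding fs[OF x] by (intro cell_inf_mono) simp_all
    qed
  qed
  moreover have "is_seq_sup fs f"
    unfolding lsc_is_seq_sup_iff
  proof
    fix x
    show "lsc_apply f x = (SUP k. lsc_apply (fs k) x)"
    proof (cases "x \<in> {0..1}")
      case x: True
      show ?thesis
      proof (rule antisym)
        show "(SUP k. lsc_apply (fs k) x) \<le> lsc_apply f x"
        proof (rule SUP_least, rule enat_leI)
          fix k m assume "enat m \<le> lsc_apply (fs k) x"
          then show "enat m \<le> lsc_apply f x"
            using mem_cell_star[OF x, of "n * 2 ^ k"] n_pos by (simp add: fs[OF x] enat_le_cell_inf_iff)
        qed
        show "lsc_apply f x \<le> (SUP k. lsc_apply (fs k) x)"
        proof (rule enat_leI)
          fix m assume "enat m \<le> lsc_apply f x"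
          then obtain r where r: "r > 0" "\<And>y. y \<in> {0..1} \<Longrightarrow> dist y x < r \<Longrightarrow> enat m \<le> lsc_apply f y"
            using lsc_onD_fin[OF lsc_on_lsc_apply x] by blast
          obtain j where j: "1 / real (Suc j) < r" using nat_approx_posE[OF r(1)] by blast
          \<comment> \<open>\<open>m \<le> k\<close> keeps the cap harmless, and
            \<open>Suc j \<le> k\<close> makes the mesh smaller than \<open>r\<close>.\<close>
          define k where "k = max m (Suc j)"
          have "Suc j \<le> k" by (simp add: k_def)
          also have "k \<le> 2 ^ k" by (rule less_imp_le[OF less_exp])
          also have "(2::nat) ^ k \<le> n * 2 ^ k" using n_pos by simp
          finally have "real (Suc j) \<le> real (n * 2 ^ k)" by (simp only: of_nat_le_iff)
          then have "1 / real (n * 2 ^ k) \<le> 1 / real (Suc j)" by (intro divide_left_mono) simp_all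
          then have "dist y x < r" if "y \<in> cell_star (n * 2 ^ k) x" for y
            using cell_star_dist(2)[OF that] j by linarith
          then have "enat m \<le> lsc_apply (fs k) x"
            unfolding fs[OF x] enat_le_cell_inf_iff using r(2) cell_star_dist(1)
            by (auto simp: k_def)
          also have "\<dots> \<le> (SUP k. lsc_apply (fs k) x)" by (rule SUP_upper) simp
          finally show "enat m \<le> (SUP k. lsc_apply (fs k) x)" .
        qed
      qed
    qed (simp add: lsc_apply_outside)
  qed
  ultimately show ?thesis using realised by blast
qed

theorem cu_morphism_exists:
  "\<exists>\<phi>. cu_morphism \<phi> \<and> \<phi> 1 = p \<and>
     (\<forall>k i. i < n * 2 ^ k \<longrightarrow> \<phi> (chi_above (grid_point n k i)) = X k i)"
proof -
  have "\<exists>\<phi>. cu_morphism \<phi> \<and> (\<forall>f v. realised f v \<longrightarrow> \<phi> f = v)"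
    by (rule cu_morphism_extension, rule generated_imp_H, rule generated.zero, erule (1) realised_add,
        erule (2) realised_mono, erule realised_approx, rule realised_basis)
  then obtain \<phi> where \<phi>: "cu_morphism \<phi>" "\<And>f v. realised f v \<Longrightarrow> \<phi> f = v"
    by blast
  show ?thesis
    using \<phi>(1) \<phi>(2)[OF generated_imp_H[OF generated.unit]] \<phi>(2)[OF generated_imp_H[OF generated.left]] by blast
qed

end

section \<open>Refining a finite chain\<close>

text \<open>One fixed choice per element: interpolants made at different stages must climb along the
  same sequence for \<open>refine_sup\<close>.\<close>

definition approx_seq :: "'a::cu_semigroup \<Rightarrow> nat \<Rightarrow> 'a" where
  "approx_seq x = (SOME z. (\<forall>j. z j \<lless> z (Suc j)) \<and> is_seq_sup z x)"

lemma approx_seq: "approx_seq x j \<lless> approx_seq x (Suc j)" "is_seq_sup (approx_seq x) x"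
  using someI_ex[OF O2[of x]] by (simp_all add: approx_seq_def)

lemma incseq_approx_seq: "incseq (approx_seq x)"
  by (intro incseq_SucI way_below_imp_le approx_seq)

text \<open>
  Interpolants at stage \<open>k\<close> are chosen above the \<open>k\<close>-th approximation of their upper neighbour;
  this makes the refined chain continuous from the right at every grid point.
\<close>

definition between :: "nat \<Rightarrow> 'a::cu_semigroup \<Rightarrow> 'a \<Rightarrow> 'a" where
  "between k x y = approx_seq y (SOME l. k \<le> l \<and> x \<lless> approx_seq y l)"

lemma between:
  assumes "x \<lless> y"
  shows "x \<lless> between k x y" "between k x y \<lless> y" "approx_seq y k \<le> between k x y"
proof -
  obtain l where "x \<le> approx_seq y l"
    using way_belowD[OF assms incseq_approx_seq approx_seq(2)] by blast
  then have "x \<lless> approx_seq y (Suc l)"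
    using approx_seq(1) way_below_mono by blast
  moreover have "approx_seq y (Suc l) \<le> approx_seq y (max k (Suc l))"
    by (intro incseqD[OF incseq_approx_seq]) simp
  ultimately have "x \<lless> approx_seq y (max k (Suc l))"
    using way_below_mono by blast
  then have "\<exists>l. k \<le> l \<and> x \<lless> approx_seq y l" by (intro exI[of _ "max k (Suc l)"]) simp
  from someI_ex[OF this] obtain m where m: "between k x y = approx_seq y m" "k \<le> m" "x \<lless> approx_seq y m"
    unfolding between_def by blast
  show "x \<lless> between k x y" using m by simp
  show "between k x y \<lless> y"
    unfolding m(1) using approx_seq(1) is_seq_sup_upper[OF approx_seq(2)] way_below_mono by blast
  show "approx_seq y k \<le> between k x y"
    unfolding m(1) using m(2) by (rule incseqD[OF incseq_approx_seq])
qed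

primrec refine :: "(nat \<Rightarrow> 'a::cu_semigroup) \<Rightarrow> nat \<Rightarrow> nat \<Rightarrow> 'a" where
  "refine x 0 = x"
| "refine x (Suc k) = (\<lambda>i. if even i then refine x k (i div 2)
     else between k (refine x k (Suc (i div 2))) (refine x k (i div 2)))"

lemma refine_refine: "refine x (k + d) (2 ^ d * i) = refine x k i"
  by (rule iterate_double) simp

context
  fixes x :: "nat \<Rightarrow> 'a :: cu_semigroup"
  assumes chain: "\<And>i. x (Suc i) \<lless> x i"
begin

lemma refine_way_below: "refine x k (Suc i) \<lless> refine x k i"
proof (induction k arbitrary: i)
  case 0
  then show ?case using chain by simp
next
  case (Suc k)
  show ?case
  proof (cases "even i")
    case True
    then show ?thesis using between(2)[OF Suc] by simp
  next
    case False
    then have "Suc i div 2 = Suc (i div 2)" by presburger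
    then show ?thesis using between(1)[OF Suc] False by simp
  qed
qed

text \<open>The right neighbour created at stage \<open>k + Suc j\<close> lies above the approximant
  number \<open>k + j\<close> of the value at the point, and these approximants exhaust that
  value.\<close>

lemma refine_sup: "is_seq_sup (\<lambda>d. refine x (k + Suc d) (2 ^ Suc d * i + 1)) (refine x k i)"
proof (rule is_seq_supI)
  fix d
  show "refine x (k + Suc d) (2 ^ Suc d * i + 1) \<le> refine x k i"
    using way_below_imp_le[OF refine_way_below[of "k + Suc d" "2 ^ Suc d * i"]]
    by (simp only: refine_refine Suc_eq_plus1)
next
  fix u assume u: "\<And>d. refine x (k + Suc d) (2 ^ Suc d * i + 1) \<le> u"
  show "refine x k i \<le> u"
  proof (rule is_seq_sup_least[OF approx_seq(2)])
    fix j
    have "(2 ^ Suc j * i + 1) div 2 = 2 ^ j * i" "odd (2 ^ Suc j * i + 1)" by simp_all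
    then have "refine x (k + Suc j) (2 ^ Suc j * i + 1)
        = between (k + j) (refine x (k + j) (Suc (2 ^ j * i))) (refine x k i)"
      using refine_refine[of x k j i] by simp
    moreover have "approx_seq (refine x k i) (k + j)
        \<le> between (k + j) (refine x (k + j) (Suc (2 ^ j * i))) (refine x k i)"
      using between(3)[OF refine_way_below[of "k + j" "2 ^ j * i"]] by (simp only: refine_refine)
    moreover have "approx_seq (refine x k i) j \<le> approx_seq (refine x k i) (k + j)"
      by (intro incseqD[OF incseq_approx_seq]) simp
    ultimately show "approx_seq (refine x k i) j \<le> u"
      using u[of j] by (metis order_trans)
  qed
qed

end

section \<open>Complementary elements\<close>

locale refined_chain =
  fixes n :: nat
    and p :: "'a :: {weakly_cancellative_cu_semigroup, cu_semigroup_O5}"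
    and X :: "nat \<Rightarrow> nat \<Rightarrow> 'a"
  assumes n_pos: "n > 0"
    and p: "compact_elem p"
    and X_double: "X (Suc k) (2 * i) = X k i"
    and X_end: "X k (n * 2 ^ k) = 0"
    and X_le: "X k i \<le> p"
    and X_way_below: "X k (Suc i) \<lless> X k i"
    and X_sup: "is_seq_sup (\<lambda>d. X (k + Suc d) (2 ^ Suc d * i + 1)) (X k i)"
begin

text \<open>
  For \<open>t\<^sub>i = i / (n 2\<^sup>k)\<close>, the element \<open>coarse_complement k i\<close> is a coarse complement of the chain, squeezed between
  the prospective images of \<open>\<chi>[0,t\<^sub>i)\<close> and \<open>\<chi>[0,t\<^bsub>i+1\<^esub>)\<close>.
\<close>

definition coarse_complement :: "nat \<Rightarrow> nat \<Rightarrow> 'a" where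
  "coarse_complement k i = (SOME c. X k (Suc i) + c \<le> p \<and> p \<le> X k i + c)"

lemma coarse_complement: "X k (Suc i) + coarse_complement k i \<le> p" "p \<le> X k i + coarse_complement k i"
proof -
  have "\<exists>c. X k (Suc i) + c \<le> p \<and> p \<le> X k i + c"
    using O5[of "X k i" 0 p "X k (Suc i)" 0] X_le X_way_below zero_way_below[of "0 :: 'a"] by auto
  from someI_ex[OF this] show "X k (Suc i) + coarse_complement k i \<le> p" "p \<le> X k i + coarse_complement k i"
    by (simp_all add: coarse_complement_def)
qed

lemmas X_iterate_double = iterate_double[of X, OF X_double]

text \<open>With h the mesh at level \<open>k + Suc j\<close> and t = i / (n 2^k), this is the
  coarse complement for the cell from t - 2h to t - h. Halving h turns t - 2h into the former t - h,
  so consecutive terms share an element of \<open>X\<close> and become comparable. The subtraction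
  does not truncate for \<open>i > 0\<close>.\<close>

definition complement_seq :: "nat \<Rightarrow> nat \<Rightarrow> nat \<Rightarrow> 'a" where
  "complement_seq k i j = coarse_complement (k + Suc j) (2 ^ Suc j * i - 2)"

lemma complement_seq:
  assumes "0 < i"
  shows "X (k + Suc j) (2 ^ Suc j * i - 1) + complement_seq k i j \<le> p"
    "p \<le> X (k + j) (2 ^ j * i - 1) + complement_seq k i j"
proof -
  have "0 < 2 ^ j * i" using assms by simp
  then obtain m where m: "2 ^ j * i = Suc m" using gr0_implies_Suc by blast
  have *: "2 ^ Suc j * i = Suc (Suc (2 * m))" using m by simp
  show "X (k + Suc j) (2 ^ Suc j * i - 1) + complement_seq k i j \<le> p"
    using coarse_complement(1)[of "k + Suc j" "2 * m"] unfolding complement_seq_def * by simp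
  show "p \<le> X (k + j) (2 ^ j * i - 1) + complement_seq k i j"
    using coarse_complement(2)[of "k + Suc j" "2 * m"] X_double[of "k + j" m] unfolding complement_seq_def * m by simp
qed

lemma complement_seq_way_below: "0 < i \<Longrightarrow> complement_seq k i j \<lless> complement_seq k i (Suc j)"
  using complement_way_below[OF p complement_seq(1) complement_seq(2)] by blast

lemma incseq_complement_seq: "0 < i \<Longrightarrow> incseq (complement_seq k i)"
  by (intro incseq_SucI way_below_imp_le complement_seq_way_below)

text \<open>Index 0 is set apart: there the index in \<open>complement_seq\<close> truncates to 0,
  while the empty interval [0,0) must go to 0.\<close>

definition Y :: "nat \<Rightarrow> nat \<Rightarrow> 'a" where
  "Y k i = (if i = 0 then 0 else SOME y. is_seq_sup (complement_seq k i) y)"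

lemma Y: "0 < i \<Longrightarrow> is_seq_sup (complement_seq k i) (Y k i)"
  using someI_ex[OF O1[OF incseq_complement_seq]] by (simp add: Y_def)

lemma X_add_Y_le: "X k i + Y k i \<le> p"
proof (cases "i = 0")
  case True
  then show ?thesis using X_le by (simp add: Y_def)
next
  case False
  then have i: "0 < i" by simp
  have "is_seq_sup (\<lambda>j. X k i + complement_seq k i j) (X k i + Y k i)"
    by (rule O4[OF _ incseq_complement_seq[OF i] is_seq_sup_const Y[OF i]]) (simp add: monotone_on_def)
  then show ?thesis
  proof (rule is_seq_sup_least)
    fix j
    have "0 < 2 ^ Suc j * i" using i by simp
    then have "Suc (2 ^ Suc j * i - 1) = 2 ^ Suc j * i" by simp
    then have "X k i \<lless> X (k + Suc j) (2 ^ Suc j * i - 1)"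
      using X_way_below[of "k + Suc j" "2 ^ Suc j * i - 1"] by (simp only: X_iterate_double)
    then have "X k i + complement_seq k i j \<le> X (k + Suc j) (2 ^ Suc j * i - 1) + complement_seq k i j"
      by (intro add_right_mono way_below_imp_le)
    then show "X k i + complement_seq k i j \<le> p" using complement_seq(1)[OF i] order_trans by blast
  qed
qed

lemma p_le_X_add_Y: "p \<le> X k i + Y k (Suc i)"
proof -
  \<comment> \<open>At \<open>j = 0\<close> the second bound involves
    \<open>X k (Suc i - 1)\<close>, so the first term of the sequence suffices.\<close>
  have "p \<le> X k i + complement_seq k (Suc i) 0" using complement_seq(2)[of "Suc i" k 0] by simp
  also have "\<dots> \<le> X k i + Y k (Suc i)"
    by (intro add_left_mono is_seq_sup_upper[OF Y]) simp
  finally show ?thesis .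
qed

lemma Y_way_below: "Y k i \<lless> Y k (Suc i)"
  using complement_way_below[OF p X_add_Y_le p_le_X_add_Y] .

text \<open>The defining sequence at the finer level is a tail of the one at the coarser
  level.\<close>

lemma Y_double: "Y (Suc k) (2 * i) = Y k i"
proof (cases "i = 0")
  case True
  then show ?thesis by (simp add: Y_def)
next
  case False
  then have i: "0 < i" "0 < 2 * i" by simp_all
  have "complement_seq (Suc k) (2 * i) = (\<lambda>j. complement_seq k i (j + 1))"
    by (rule ext) (simp add: complement_seq_def ac_simps)
  then have "is_seq_sup (complement_seq (Suc k) (2 * i)) (Y k i)"
    using Y[OF i(1)] is_seq_sup_offset[OF incseq_complement_seq[OF i(1)], of k 1 "Y k i"] by simp
  then show ?thesis using is_seq_sup_unique Y[OF i(2)] by blast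
qed

lemmas Y_iterate_double = iterate_double[of Y, OF Y_double]

lemma Y_sup:
  assumes "0 < i"
  shows "is_seq_sup (\<lambda>d. Y (k + Suc d) (2 ^ Suc d * i - 1)) (Y k i)"
proof (rule is_seq_supI)
  fix d
  have "0 < 2 ^ Suc d * i" using assms by simp
  then have "Suc (2 ^ Suc d * i - 1) = 2 ^ Suc d * i" by simp
  then have "Y (k + Suc d) (2 ^ Suc d * i - 1) \<lless> Y k i"
    using Y_way_below[of "k + Suc d" "2 ^ Suc d * i - 1"] by (simp only: Y_iterate_double)
  then show "Y (k + Suc d) (2 ^ Suc d * i - 1) \<le> Y k i" by (rule way_below_imp_le)
next
  fix u assume u: "\<And>d. Y (k + Suc d) (2 ^ Suc d * i - 1) \<le> u"
  show "Y k i \<le> u"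
  proof (rule is_seq_sup_least[OF Y[OF assms]])
    fix j
    have "0 < 2 ^ Suc j * i" using assms by simp
    then obtain m where m: "2 ^ Suc j * i = Suc m" using gr0_implies_Suc by blast
    \<comment> \<open>With h the mesh at level \<open>k + Suc j\<close> and t the point of
      \<open>Y k i\<close>, \<open>m\<close> marks t - h and this index marks t - h/2. The value of
      \<open>X\<close> at t - h separates term \<open>j\<close> from \<open>Y\<close> at t -
      h/2.\<close>
    have *: "2 ^ Suc (Suc j) * i - 1 = Suc (2 * m)" using m by simp
    have "X (k + Suc j) m + complement_seq k i j \<le> p" using complement_seq(1)[OF assms, of k j] unfolding m by simp
    moreover have "p \<le> X (k + Suc j) m + Y (k + Suc (Suc j)) (2 ^ Suc (Suc j) * i - 1)"
      using p_le_X_add_Y[of "k + Suc (Suc j)" "2 * m"] X_double[of "k + Suc j" m] unfolding * by simp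
    ultimately have "complement_seq k i j \<lless> Y (k + Suc (Suc j)) (2 ^ Suc (Suc j) * i - 1)"
      using complement_way_below[OF p] by blast
    then show "complement_seq k i j \<le> u" using u[of "Suc j"] way_below_imp_le order_trans by blast
  qed
qed

sublocale generator_system n p X Y
proof
  show "cancellable p" using compact_cancellable[OF p] .
qed (simp_all only: n_pos X_double Y_double X_end X_add_Y_le p_le_X_add_Y X_way_below Y_way_below
  X_sup Y_sup, simp add: Y_def)

end

theorem theorem3p1:
  fixes s :: "nat \<Rightarrow> 'a :: {weakly_cancellative_cu_semigroup, cu_semigroup_O5}"
    and n :: nat and p :: 'a
  assumes "n \<ge> 1"
    and "\<And>k. 1 \<le> k \<Longrightarrow> k < n \<Longrightarrow> s k \<lless> s (Suc k)"
    and "compact_elem p"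
    and "s n \<le> p"
  shows "\<exists>\<phi> :: lsc01 \<Rightarrow> 'a. cu_morphism \<phi> \<and>
           (\<forall>k. 1 \<le> k \<and> k \<le> n \<longrightarrow> \<phi> (lsc_indicator {(real n - real k) / real n <.. 1}) = s k) \<and>
           \<phi> 1 = p"
proof -
  \<comment> \<open>Position \<open>i\<close> stands for the point i/n, so the order is reversed:
    the indicator of (i/n,1] has to go to \<open>s (n - i)\<close>. From \<open>i = n\<close> on the
    interval is empty, hence 0.\<close>
  define x where "x i = (if i < n then s (n - i) else 0)" for i
  have chain: "x (Suc i) \<lless> x i" for i
  proof (cases "Suc i < n")
    case True
    then have "Suc (n - Suc i) = n - i" by simp
    then show ?thesis using assms(2)[of "n - Suc i"] True by (simp add: x_def)
  next
    case False
    then show ?thesis by (simp add: x_def zero_way_below)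
  qed
  have le_first: "refine x k i \<le> refine x k 0" for k i
    using way_below_imp_le[OF refine_way_below[of x, OF chain]]
    by (induction i) (auto intro: order_trans)
  interpret refined_chain n p "refine x"
  proof
    show "refine x k (n * 2 ^ k) = 0" for k
      using refine_refine[of x 0 k n] by (simp add: x_def mult.commute)
    have "refine x k 0 = s n" for k
      using refine_refine[of x 0 k 0] assms(1) by (simp add: x_def)
    then show "refine x k i \<le> p" for k i
      using le_first[of k i] assms(4) by simp
    show "refine x (Suc k) (2 * i) = refine x k i" for k i by simp
  qed (use assms(1,3) refine_way_below[of x, OF chain] refine_sup[of x, OF chain] in simp_all)
  obtain \<phi> where \<phi>: "cu_morphism \<phi>" "\<phi> 1 = p"
    "\<And>k i. i < n * 2 ^ k \<Longrightarrow> \<phi> (chi_above (grid_point n k i)) = refine x k i"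
    using cu_morphism_exists by blast
  \<comment> \<open>Level 0 suffices: the points (n - k)/n are its grid points, and
    \<open>refine x 0\<close> is \<open>x\<close>.\<close>
  have "\<phi> (lsc_indicator {(real n - real k) / real n <.. 1}) = s k" if "1 \<le> k \<and> k \<le> n" for k
    using \<phi>(3)[of "n - k" 0] that by (simp add: chi_above_def grid_point_def x_def of_nat_diff)
  then show ?thesis using \<phi>(1,2) by blast
qed

end
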